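(* For every integer $k$, there are polynomial-time algorithms (whose polynomial degree may depend on $k$) that, given a $kK_1$-free graph $G$, decide whether $G$ has a Hamiltonian path and whether $G$ has a Hamiltonian cycle.
   Context: Graphs are finite, simple and undirected. $kK_1$ denotes the edgeless graph on $k$ vertices; a graph is $kK_1$-free if it has no induced subgraph isomorphic to $kK_1$, i.e., its independence number $\alpha(G)$ (the maximum size of an independent set) is less than $k$. A Hamiltonian path (cycle) is a path (cycle) containing all vertices of the graph. *)

theory Defs
  imports "Graph_Theory.Graph_Theory" "HOL-Computational_Algebra.Polynomial"
begin

section \<open>Graphs\<close>

text \<open>
  Finite simple undirected graphs are the symmetric loop-free finite digraphs without parallel
  arcs, \<^locale>\<open>pair_graph\<close>: an edge \<open>uv\<close> is the pair of arcs \<open>(u, v)\<close>, \<open>(v, u)\<close>.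
\<close>

definition edgeless_graph :: "nat \<Rightarrow> nat pair_pre_digraph" where
  "edgeless_graph k = \<lparr>pverts = {..<k}, parcs = {}\<rparr>"

definition kK1_free :: "nat \<Rightarrow> 'a pair_pre_digraph \<Rightarrow> bool" where
  "kK1_free k G \<longleftrightarrow>
     \<not> (\<exists>H :: 'a pair_pre_digraph.
           induced_subgraph (with_proj H) (with_proj G) \<and>
           digraph_iso (with_proj (edgeless_graph k)) (with_proj H))"

definition independent_set :: "'a pair_pre_digraph \<Rightarrow> 'a set \<Rightarrow> bool" where
  "independent_set G S \<longleftrightarrow> S \<subseteq> pverts G \<and> (\<forall>u\<in>S. \<forall>v\<in>S. (u, v) \<notin> parcs G)"

definition independence_number :: "'a pair_pre_digraph \<Rightarrow> nat" where
  "independence_number G = Max (card ` {S. independent_set G S})"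

definition has_hamiltonian_path :: "'a pair_pre_digraph \<Rightarrow> bool" where
  "has_hamiltonian_path G \<longleftrightarrow> (\<exists>p. vpath p (with_proj G) \<and> set p = pverts G)"

text \<open>
  The bound on the length is needed because a single edge \<open>uv\<close>, traversed back and forth, is a
  closed walk in the digraph but not a cycle of the undirected graph.
\<close>

definition has_hamiltonian_cycle :: "'a pair_pre_digraph \<Rightarrow> bool" where
  "has_hamiltonian_cycle G \<longleftrightarrow>
     (\<exists>p. vpath p (with_proj G) \<and> set p = pverts G \<and> 3 \<le> length p \<and> (last p, hd p) \<in> parcs G)"

lemma kK1_free_iff_no_independent_set:
  assumes "pair_graph G"
  shows "kK1_free k G \<longleftrightarrow> \<not> (\<exists>S. independent_set G S \<and> card S = k)"
proof -
  interpret pair_graph G by fact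
  have "(\<exists>H. induced_subgraph (with_proj H) (with_proj G) \<and>
             digraph_iso (with_proj (edgeless_graph k)) (with_proj H))
        \<longleftrightarrow> (\<exists>S. independent_set G S \<and> card S = k)" (is "?L \<longleftrightarrow> ?R")
  proof
    assume ?L
    then obtain H f where
      H: "induced_subgraph (with_proj H) (with_proj G)" and
      f: "pre_digraph.digraph_isomorphism (with_proj (edgeless_graph k)) f" and
      eq: "with_proj H = app_iso f (with_proj (edgeless_graph k))"
      by (auto simp: digraph_iso_def)
    have "pverts H = verts (with_proj H)" "parcs H = arcs (with_proj H)"
      by simp_all
    then have "pverts H = iso_verts f ` {..<k}" "parcs H = {}"
      unfolding eq by (simp_all add: edgeless_graph_def)
    moreover have "inj_on (iso_verts f) {..<k}"
      using f by (simp add: pre_digraph.digraph_isomorphism_def edgeless_graph_def)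
    ultimately have "card (pverts H) = k" and *: "parcs H = {}"
      by (simp_all add: card_image)
    have "pverts H \<subseteq> pverts G" "parcs H = {e \<in> parcs G. fst e \<in> pverts H \<and> snd e \<in> pverts H}"
      using H by (simp_all add: induced_subgraph_def subgraph_def)
    with * have "independent_set G (pverts H)"
      unfolding independent_set_def by force
    with \<open>card (pverts H) = k\<close> show ?R by blast
  next
    assume ?R
    then obtain S where S: "S \<subseteq> pverts G" "\<forall>u\<in>S. \<forall>v\<in>S. (u, v) \<notin> parcs G" "card S = k"
      by (auto simp: independent_set_def)
    then have "finite S"
      using finite_subset pair_finite_verts by blast
    then obtain g where g: "bij_betw g {..<k} S"
      using S(3) ex_bij_betw_nat_finite[of S] by (auto simp: atLeast0LessThan)
    define H where "H = \<lparr>pverts = S, parcs = {} :: ('a \<times> 'a) set\<rparr>"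
    define f :: "(nat, nat \<times> nat, 'a, 'a \<times> 'a) digraph_isomorphism" where
      "f = \<lparr>iso_verts = g, iso_arcs = map_prod g g, iso_head = snd, iso_tail = fst\<rparr>"
    have wfH: "wf_digraph (with_proj H)"
      by unfold_locales (auto simp: H_def)
    have "induced_subgraph (with_proj H) (with_proj G)"
      using S wfH wf_digraph_axioms
      by (auto simp: induced_subgraph_def subgraph_def H_def with_proj_def compatible_def)
    moreover have "wf_digraph (with_proj (edgeless_graph k))"
      by unfold_locales (auto simp: edgeless_graph_def)
    then have "digraph_iso (with_proj (edgeless_graph k)) (with_proj H)"
      unfolding digraph_iso_def pre_digraph.digraph_isomorphism_def
      using g
      by (intro exI[of _ f])
         (auto simp: f_def H_def edgeless_graph_def app_iso_def with_proj_def bij_betw_def)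
    ultimately show ?L by blast
  qed
  then show ?thesis
    by (simp add: kK1_free_def)
qed

lemma kK1_free_iff_independence_number:
  assumes "pair_graph G"
  shows "kK1_free k G \<longleftrightarrow> independence_number G < k"
proof -
  interpret pair_graph G by fact
  let ?C = "card ` {S. independent_set G S}"
  have "{S. independent_set G S} \<subseteq> Pow (pverts G)"
    by (auto simp: independent_set_def)
  then have fin: "finite ?C"
    by (meson finite_Pow_iff finite_imageI finite_subset pair_finite_verts)
  have "independent_set G {}"
    by (simp add: independent_set_def)
  then have ne: "?C \<noteq> {}"
    by blast
  have "(\<exists>S. independent_set G S \<and> card S = k) \<longleftrightarrow> k \<le> independence_number G" (is "?L \<longleftrightarrow> ?R")
  proof
    assume ?L
    then show ?R
      unfolding independence_number_def using Max_ge[OF fin] by blast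
  next
    assume ?R
    moreover have "independence_number G \<in> ?C"
      unfolding independence_number_def using fin ne by (rule Max_in)
    ultimately obtain S where S: "independent_set G S" "k \<le> card S"
      by auto
    then obtain T where "T \<subseteq> S" "card T = k"
      by (meson obtain_subset_with_card_n)
    moreover from this have "independent_set G T"
      using S(1) unfolding independent_set_def by blast
    ultimately show ?L by blast
  qed
  then show ?thesis
    using kK1_free_iff_no_independent_set[OF assms] by auto
qed


section \<open>Polynomial-time algorithms\<close>

text \<open>
  The machine model is the random access machine, programmed with structured control flow. It has
  registers and an indirectly addressed memory, both holding natural numbers. Every elementary
  operation and every test costs one time unit. The only arithmetic is addition and (truncated)
  subtraction, so, apart from loading a constant of the program, a step lengthens the largest
  number present by at most one bit; hence unit-cost time is polynomially related to
  Turing machine time. Unit-cost multiplication would break this.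
\<close>

type_synonym register = nat

datatype com =
    Skip
  | Const register nat
  | Move register register
  | Add register register register
  | Sub register register register
  | Load register register
  | Store register register
  | Seq com com
  | IfNonzero register com com
  | WhileNonzero register com

record ram_state =
  reg :: "register \<Rightarrow> nat"
  mem :: "nat \<Rightarrow> nat"

abbreviation set_reg :: "register \<Rightarrow> nat \<Rightarrow> ram_state \<Rightarrow> ram_state" where
  "set_reg r x s \<equiv> s\<lparr>reg := (reg s)(r := x)\<rparr>"

abbreviation set_mem :: "nat \<Rightarrow> nat \<Rightarrow> ram_state \<Rightarrow> ram_state" where
  "set_mem a x s \<equiv> s\<lparr>mem := (mem s)(a := x)\<rparr>"

text \<open>
  \<open>exec c s t s'\<close>: started in state \<open>s\<close>, the program \<open>c\<close> halts in state \<open>s'\<close> after exactly \<open>t\<close> steps.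
\<close>

inductive exec :: "com \<Rightarrow> ram_state \<Rightarrow> nat \<Rightarrow> ram_state \<Rightarrow> bool" where
  Skip: "exec Skip s 1 s"
| Const: "exec (Const r x) s 1 (set_reg r x s)"
| Move: "exec (Move r p) s 1 (set_reg r (reg s p) s)"
| Add: "exec (Add r p q) s 1 (set_reg r (reg s p + reg s q) s)"
| Sub: "exec (Sub r p q) s 1 (set_reg r (reg s p - reg s q) s)"
| Load: "exec (Load r p) s 1 (set_reg r (mem s (reg s p)) s)"
| Store: "exec (Store p r) s 1 (set_mem (reg s p) (reg s r) s)"
| Seq: "\<lbrakk>exec c1 s1 t1 s2; exec c2 s2 t2 s3\<rbrakk> \<Longrightarrow> exec (Seq c1 c2) s1 (t1 + t2) s3"
| IfTrue: "\<lbrakk>reg s r \<noteq> 0; exec c1 s t s'\<rbrakk> \<Longrightarrow> exec (IfNonzero r c1 c2) s (t + 1) s'"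
| IfFalse: "\<lbrakk>reg s r = 0; exec c2 s t s'\<rbrakk> \<Longrightarrow> exec (IfNonzero r c1 c2) s (t + 1) s'"
| WhileFalse: "reg s r = 0 \<Longrightarrow> exec (WhileNonzero r c) s 1 s"
| WhileTrue: "\<lbrakk>reg s1 r \<noteq> 0; exec c s1 t1 s2; exec (WhileNonzero r c) s2 t2 s3\<rbrakk> \<Longrightarrow>
    exec (WhileNonzero r c) s1 (t1 + t2 + 1) s3"

inductive_cases Skip_exec: "exec Skip s t s'"
  and Const_exec: "exec (Const r x) s t s'"
  and Move_exec: "exec (Move r p) s t s'"
  and Add_exec: "exec (Add r p q) s t s'"
  and Sub_exec: "exec (Sub r p q) s t s'"
  and Load_exec: "exec (Load r p) s t s'"
  and Store_exec: "exec (Store p r) s t s'"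
  and Seq_exec: "exec (Seq c1 c2) s t s'"
  and If_exec: "exec (IfNonzero r c1 c2) s t s'"
  and While_exec: "exec (WhileNonzero r c) s t s'"

lemma exec_deterministic:
  "\<lbrakk>exec c s t s'; exec c s u s''\<rbrakk> \<Longrightarrow> t = u \<and> s' = s''"
proof (induction arbitrary: u s'' rule: exec.induct)
  case (Seq c1 s1 t1 s2 c2 t2 s3)
  from Seq.prems obtain v1 v2 s where "u = v1 + v2" "exec c1 s1 v1 s" "exec c2 s v2 s''"
    by (rule Seq_exec)
  with Seq.IH show ?case by metis
next
  case (IfTrue s r c1 t s' c2)
  then obtain v where "u = v + 1" "exec c1 s v s''"
    by (metis If_exec Suc_eq_plus1 less_irrefl)
  with IfTrue.IH show ?case by metis
next
  case (IfFalse s r c2 t s' c1)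
  then obtain v where "u = v + 1" "exec c2 s v s''"
    by (metis If_exec Suc_eq_plus1 less_irrefl)
  with IfFalse.IH show ?case by metis
next
  case (WhileFalse s r c)
  then show ?case
    by (metis While_exec One_nat_def less_irrefl)
next
  case (WhileTrue s1 r c t1 s2 t2 s3)
  then obtain v1 v2 s where "u = v1 + v2 + 1" "exec c s1 v1 s" "exec (WhileNonzero r c) s v2 s''"
    by (metis While_exec Suc_eq_plus1)
  with WhileTrue.IH show ?case by metis
qed (auto elim: Skip_exec Const_exec Move_exec Add_exec Sub_exec Load_exec Store_exec)

text \<open>
  A graph with vertex set \<open>{..<n}\<close> is given by \<open>n\<close> in register \<open>0\<close> and its adjacency matrix in
  row-major order, i.e. the entry for \<open>(u, v)\<close> at address \<open>u * n + v\<close>.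
\<close>

definition input_state :: "nat \<Rightarrow> nat pair_pre_digraph \<Rightarrow> ram_state" where
  "input_state n G =
     \<lparr>reg = (\<lambda>r. if r = 0 then n else 0),
      mem = (\<lambda>a. if (a div n, a mod n) \<in> parcs G then 1 else 0)\<rparr>"

text \<open>
  On the class \<open>C\<close> of graphs, \<open>c\<close> halts with the answer (\<open>1\<close> for yes, \<open>0\<close> for no) in register \<open>0\<close>,
  in time polynomial in the number of vertices, and hence in the input size.
\<close>

definition decides_in_poly_time ::
  "com \<Rightarrow> (nat pair_pre_digraph \<Rightarrow> bool) \<Rightarrow> (nat pair_pre_digraph \<Rightarrow> bool) \<Rightarrow> bool" where
  "decides_in_poly_time c C Q \<longleftrightarrow>
     (\<exists>p :: nat poly. \<forall>n G. pair_graph G \<and> pverts G = {..<n} \<and> C G \<longrightarrow>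
        (\<exists>t s. exec c (input_state n G) t s \<and> t \<le> poly p n \<and>
               reg s 0 = (if Q G then 1 else 0)))"

end

theory Submission
  imports Defs
begin

text \<open>
  Let \<open>G\<close> have no independent set of size \<open>k\<close>. If some component of \<open>G - S\<close> can be split by
  deleting few vertices, add these to \<open>S\<close>. Each step yields one more component, and components
  have independent transversals, so this stops with a set \<open>S\<close> of bounded size such that all
  components of \<open>G - S\<close> are highly connected relative to the size of \<open>S\<close>. A Hamiltonian path cuts
  into at most \<open>|S| + 1\<close> segments in \<open>G - S\<close>; recording only \<open>S\<close> and the ends of the segments gives
  a skeleton of bounded size. Conversely, a skeleton for such an \<open>S\<close> can be realized: induced paths
  have fewer than \<open>2 * k\<close> vertices, so the segments can be filled in greedily by short disjoint
  paths, and a path that misses a vertex is enlarged by the argument of Chvatal and Erdos. Hence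
  \<open>G\<close> has a Hamiltonian path between two given vertices iff every set \<open>S\<close> of bounded size has a
  skeleton, so that no separator has to be found. This is a first-order property of \<open>G\<close>, and
  every first-order property is decided in polynomial time by nested loops over the vertices.
\<close>

section \<open>Deciding first-order properties\<close>

text \<open>
  The predicates below are first-order formulas over the graph with a list of vertices as free
  variables. Variable number \<open>i\<close> is kept in register \<open>2 * i + 2\<close>; a program with \<open>d\<close> free variables
  may overwrite the registers from \<open>2 * d + 2\<close> on and leaves its answer in the first of them.
  Register \<open>1\<close> holds the constant \<open>1\<close>.
\<close>

definition represents :: "nat \<Rightarrow> (nat \<Rightarrow> nat \<Rightarrow> bool) \<Rightarrow> ram_state \<Rightarrow> bool" where
  "represents n E s \<longleftrightarrow> reg s 0 = n \<and> reg s 1 = 1 \<and>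
     mem s = (\<lambda>a. if E (a div n) (a mod n) then 1 else 0)"

definition env :: "nat \<Rightarrow> ram_state \<Rightarrow> nat list" where
  "env d s = map (\<lambda>i. reg s (2 * i + 2)) [0..<d]"

definition decided_by :: "com \<Rightarrow> nat poly \<Rightarrow> nat \<Rightarrow> (nat \<Rightarrow> (nat \<Rightarrow> nat \<Rightarrow> bool) \<Rightarrow> nat list \<Rightarrow> bool) \<Rightarrow> bool" where
  "decided_by c q d P \<longleftrightarrow> (\<forall>n E s. represents n E s \<and> set (env d s) \<subseteq> {..<n} \<longrightarrow>
     (\<exists>t s'. exec c s t s' \<and> t \<le> poly q n \<and> mem s' = mem s \<and>
        (\<forall>r < 2 * d + 2. reg s' r = reg s r) \<and>
        reg s' (2 * d + 2) = (if P n E (env d s) then 1 else 0)))"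

definition fo_decidable :: "nat \<Rightarrow> (nat \<Rightarrow> (nat \<Rightarrow> nat \<Rightarrow> bool) \<Rightarrow> nat list \<Rightarrow> bool) \<Rightarrow> bool" where
  "fo_decidable d P \<longleftrightarrow> (\<exists>c q. decided_by c q d P)"

lemma decided_byD:
  "\<lbrakk>decided_by c q d P; represents n E s; set (env d s) \<subseteq> {..<n}\<rbrakk> \<Longrightarrow>
     \<exists>t s'. exec c s t s' \<and> t \<le> poly q n \<and> mem s' = mem s \<and>
        (\<forall>r < 2 * d + 2. reg s' r = reg s r) \<and>
        reg s' (2 * d + 2) = (if P n E (env d s) then 1 else 0)"
  unfolding decided_by_def by blast

lemma length_env [simp]: "length (env d s) = d"
  by (simp add: env_def)

lemma env_nth [simp]: "i < d \<Longrightarrow> env d s ! i = reg s (2 * i + 2)"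
  by (simp add: env_def)

lemma env_Suc: "env (Suc d) s = env d s @ [reg s (2 * d + 2)]"
  by (simp add: env_def)

lemma env_cong: "(\<And>r. r < 2 * d + 2 \<Longrightarrow> reg s' r = reg s r) \<Longrightarrow> env d s' = env d s"
  by (simp add: env_def)

lemma represents_cong:
  "\<lbrakk>represents n E s; mem s' = mem s; \<And>r. r < 2 * d + 2 \<Longrightarrow> reg s' r = reg s r\<rbrakk> \<Longrightarrow> represents n E s'"
  by (simp add: represents_def)

text \<open>Applied first, this leaves the step count and the final state open until the rules of
  \<open>exec\<close> determine them; the time bound and the answer are checked afterwards.\<close>

lemma exec_witness: "\<lbrakk>exec c s t s'; Q t s'\<rbrakk> \<Longrightarrow> \<exists>t s'. exec c s t s' \<and> Q t s'"
  by blast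

lemma decidedI:
  assumes "\<And>n E s. represents n E s \<Longrightarrow> set (env d s) \<subseteq> {..<n} \<Longrightarrow>
     \<exists>t s'. exec c s t s' \<and> t \<le> poly q n \<and> mem s' = mem s \<and>
        (\<forall>r < 2 * d + 2. reg s' r = reg s r) \<and>
        reg s' (2 * d + 2) = (if P n E (env d s) then 1 else 0)"
  shows "fo_decidable d P"
  using assms unfolding fo_decidable_def decided_by_def by blast

lemma fo_decidable_cong:
  assumes "fo_decidable d P"
    and "\<And>n E e. length e = d \<Longrightarrow> set e \<subseteq> {..<n} \<Longrightarrow> P n E e \<longleftrightarrow> Q n E e"
  shows "fo_decidable d Q"
proof -
  obtain c q where "decided_by c q d P"
    using assms(1) by (auto simp: fo_decidable_def)
  then have "decided_by c q d Q"
    unfolding decided_by_def by (simp add: assms(2))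
  then show ?thesis by (auto simp: fo_decidable_def)
qed

section \<open>Boolean connectives\<close>

lemma fo_decidable_const: "fo_decidable d (\<lambda>n E e. b)"
  by (rule decidedI[where c = "Const (2 * d + 2) (if b then 1 else 0)" and q = 1])
     (rule exec_witness[OF exec.Const], auto)

lemma fo_decidable_not:
  assumes "fo_decidable d P"
  shows "fo_decidable d (\<lambda>n E e. \<not> P n E e)"
proof -
  obtain c q where c: "decided_by c q d P"
    using assms by (auto simp: fo_decidable_def)
  show ?thesis
  proof (rule decidedI)
    fix n E s
    assume s: "represents n E s" "set (env d s) \<subseteq> {..<n}"
    then obtain t s' where t: "exec c s t s'" "t \<le> poly q n" "mem s' = mem s"
      "\<forall>r < 2 * d + 2. reg s' r = reg s r"
      "reg s' (2 * d + 2) = (if P n E (env d s) then 1 else 0)"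
      using decided_byD[OF c s] by blast
    show "\<exists>t s'. exec (Seq c (Sub (2 * d + 2) 1 (2 * d + 2))) s t s' \<and> t \<le> poly (q + 1) n \<and>
        mem s' = mem s \<and> (\<forall>r < 2 * d + 2. reg s' r = reg s r) \<and>
        reg s' (2 * d + 2) = (if \<not> P n E (env d s) then 1 else 0)"
      using t s(1)
      by - (rule exec_witness, rule exec.Seq[OF t(1) exec.Sub], auto simp: represents_def)
  qed
qed

lemma fo_decidable_conj:
  assumes "fo_decidable d P" "fo_decidable d Q"
  shows "fo_decidable d (\<lambda>n E e. P n E e \<and> Q n E e)"
proof -
  obtain c q c' q' where c: "decided_by c q d P" and c': "decided_by c' q' d Q"
    using assms by (auto simp: fo_decidable_def)
  show ?thesis
  proof (rule decidedI)
    fix n E s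
    assume s: "represents n E s" "set (env d s) \<subseteq> {..<n}"
    then obtain t s' where t: "exec c s t s'" "t \<le> poly q n" "mem s' = mem s"
      "\<forall>r < 2 * d + 2. reg s' r = reg s r"
      "reg s' (2 * d + 2) = (if P n E (env d s) then 1 else 0)"
      using decided_byD[OF c s] by blast
    have s': "represents n E s'" "env d s' = env d s"
      using t s represents_cong[of n E s s' d] env_cong[of d s' s] by auto
    then obtain t' s'' where t': "exec c' s' t' s''" "t' \<le> poly q' n" "mem s'' = mem s'"
      "\<forall>r < 2 * d + 2. reg s'' r = reg s' r"
      "reg s'' (2 * d + 2) = (if Q n E (env d s') then 1 else 0)"
      using decided_byD[OF c' s'(1)] s(2) by auto
    show "\<exists>t s'. exec (Seq c (IfNonzero (2 * d + 2) c' Skip)) s t s' \<and> t \<le> poly (q + q' + 2) n \<and>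
        mem s' = mem s \<and> (\<forall>r < 2 * d + 2. reg s' r = reg s r) \<and>
        reg s' (2 * d + 2) = (if P n E (env d s) \<and> Q n E (env d s) then 1 else 0)"
    proof (cases "P n E (env d s)")
      case True
      with t t' s' show ?thesis
        by - (rule exec_witness, rule exec.Seq[OF t(1) exec.IfTrue[OF _ t'(1)]], auto)
    next
      case False
      with t show ?thesis
        by - (rule exec_witness, rule exec.Seq[OF t(1) exec.IfFalse[OF _ exec.Skip]], auto)
    qed
  qed
qed

lemma fo_decidable_disj:
  assumes "fo_decidable d P" "fo_decidable d Q"
  shows "fo_decidable d (\<lambda>n E e. P n E e \<or> Q n E e)"
  using fo_decidable_not[OF fo_decidable_conj[OF fo_decidable_not[OF assms(1)] fo_decidable_not[OF assms(2)]]] by simp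

lemma fo_decidable_imp:
  assumes "fo_decidable d P" "fo_decidable d Q"
  shows "fo_decidable d (\<lambda>n E e. P n E e \<longrightarrow> Q n E e)"
  using fo_decidable_not[OF fo_decidable_conj[OF assms(1) fo_decidable_not[OF assms(2)]]] by simp

lemma fo_decidable_finite_all:
  assumes "finite I" "\<And>i. i \<in> I \<Longrightarrow> fo_decidable d (P i)"
  shows "fo_decidable d (\<lambda>n E e. \<forall>i\<in>I. P i n E e)"
  using assms
proof (induction I)
  case empty
  then show ?case using fo_decidable_const[of d True] by simp
next
  case (insert i I)
  then show ?case
    using fo_decidable_conj[of d "P i" "\<lambda>n E e. \<forall>i\<in>I. P i n E e"] by simp
qed

lemma fo_decidable_finite_ex:
  assumes "finite I" "\<And>i. i \<in> I \<Longrightarrow> fo_decidable d (P i)"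
  shows "fo_decidable d (\<lambda>n E e. \<exists>i\<in>I. P i n E e)"
  using fo_decidable_not[OF fo_decidable_finite_all[OF assms(1), of d "\<lambda>i n E e. \<not> P i n E e"]] assms(2) fo_decidable_not
  by simp

section \<open>Atomic formulas: equality and adjacency\<close>

lemma fo_decidable_eq:
  assumes "i < d" "j < d"
  shows "fo_decidable d (\<lambda>n E e. e ! i = e ! j)"
proof -
  let ?a = "2 * d + 2"
  show ?thesis
  proof (rule fo_decidable_cong[OF fo_decidable_conj[of d "\<lambda>n E e. e ! i \<le> e ! j" "\<lambda>n E e. e ! j \<le> e ! i"]])
    have *: "fo_decidable d (\<lambda>n E e. e ! i \<le> e ! j)" if "i < d" "j < d" for i j
    proof -
      \<comment> \<open>Truncated subtraction leaves a nonzero value exactly when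
        \<open>\<le>\<close> fails, so the program decides the negation, which is then negated
        again.\<close>
      have "fo_decidable d (\<lambda>n E e. \<not> \<not> e ! i \<le> e ! j)"
      proof (rule fo_decidable_not, rule decidedI)
        fix n E s
        assume s: "represents n E s" "set (env d s) \<subseteq> {..<n}"
        let ?c = "Seq (Sub ?a (2 * i + 2) (2 * j + 2)) (IfNonzero ?a (Const ?a 1) Skip)"
        show "\<exists>t s'. exec ?c s t s' \<and> t \<le> poly 3 n \<and> mem s' = mem s \<and>
          (\<forall>r < 2 * d + 2. reg s' r = reg s r) \<and>
          reg s' (2 * d + 2) = (if \<not> env d s ! i \<le> env d s ! j then 1 else 0)"
        proof (cases "reg s (2 * i + 2) \<le> reg s (2 * j + 2)")
          case True
          then show ?thesis using that
            by - (rule exec_witness, rule exec.Seq[OF exec.Sub exec.IfFalse[OF _ exec.Skip]], auto)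
        next
          case False
          then show ?thesis using that
            by - (rule exec_witness, rule exec.Seq[OF exec.Sub exec.IfTrue[OF _ exec.Const]], auto)
        qed
      qed
      then show ?thesis by simp
    qed
    show "fo_decidable d (\<lambda>n E e. e ! i \<le> e ! j)" "fo_decidable d (\<lambda>n E e. e ! j \<le> e ! i)"
      using * assms by auto
  qed auto
qed

text \<open>Multiplication by the content of register \<open>0\<close> is done by repeated addition,
  since the machine only adds and subtracts. A round costs one test and two instructions, and the
  last test is one more step.\<close>

lemma exec_add_loop:
  assumes "reg s 1 = 1" "a > 1" "b > 1" "a \<noteq> b"
  shows "\<exists>s'. exec (WhileNonzero b (Seq (Add a a 0) (Sub b b 1))) s (3 * reg s b + 1) s' \<and>
     mem s' = mem s \<and> (\<forall>r. r \<noteq> a \<and> r \<noteq> b \<longrightarrow> reg s' r = reg s r) \<and>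
     reg s' a = reg s a + reg s b * reg s 0"
  using assms(1)
proof (induction "reg s b" arbitrary: s)
  case 0
  then show ?case
    by (intro exI[of _ s]) (auto intro: exec.WhileFalse[of s b, simplified])
next
  case (Suc m)
  let ?s1 = "set_reg a (reg s a + reg s 0) s"
  let ?s2 = "set_reg b (reg ?s1 b - reg ?s1 1) ?s1"
  have 1: "exec (Seq (Add a a 0) (Sub b b 1)) s (1 + 1) ?s2"
    by (rule exec.Seq[OF exec.Add exec.Sub])
  have b: "reg ?s2 b = m" using Suc assms by auto
  obtain s' where s': "exec (WhileNonzero b (Seq (Add a a 0) (Sub b b 1))) ?s2 (3 * m + 1) s'"
     "mem s' = mem ?s2" "\<forall>r. r \<noteq> a \<and> r \<noteq> b \<longrightarrow> reg s' r = reg ?s2 r"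
     "reg s' a = reg ?s2 a + m * reg ?s2 0"
    using Suc(1)[of ?s2] b Suc.prems assms by auto
  have "exec (WhileNonzero b (Seq (Add a a 0) (Sub b b 1))) s ((1 + 1) + (3 * m + 1) + 1) s'"
    using exec.WhileTrue[OF _ 1 s'(1)] Suc(2) by simp
  moreover have "(1 + 1) + (3 * m + 1) + 1 = 3 * reg s b + 1"
    using Suc(2) by simp
  moreover have "reg s' a = reg s a + reg s b * reg s 0"
    using s'(4) assms Suc(2)[symmetric] by simp
  ultimately show ?case using s' by (intro exI[of _ s']) auto
qed

lemma fo_decidable_edge:
  assumes "i < d" "j < d"
  shows "fo_decidable d (\<lambda>n E e. E (e ! i) (e ! j))"
proof (rule decidedI)
  fix n E s
  assume s: "represents n E s" "set (env d s) \<subseteq> {..<n}"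
  let ?a = "2 * d + 2"
  let ?b = "2 * d + 3"
  let ?u = "reg s (2 * i + 2)"
  let ?v = "reg s (2 * j + 2)"
  let ?s2 = "set_reg ?b ?u (set_reg ?a ?v s)"
  let ?loop = "WhileNonzero ?b (Seq (Add ?a ?a 0) (Sub ?b ?b 1))"
  have "?u \<in> set (env d s)" "?v \<in> set (env d s)"
    using assms by (auto simp: env_def)
  then have uv: "?u < n" "?v < n"
    using s(2) assms by auto
  obtain s' where s': "exec ?loop ?s2 (3 * ?u + 1) s'"
     "mem s' = mem s" "\<forall>r. r \<noteq> ?a \<and> r \<noteq> ?b \<longrightarrow> reg s' r = reg s r"
     "reg s' ?a = ?v + ?u * n"
    using exec_add_loop[of ?s2 ?a ?b] s(1) by (auto simp: represents_def)
  let ?s3 = "set_reg ?a (mem s' (reg s' ?a)) s'"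
  have "exec (Move ?b (2 * i + 2)) (set_reg ?a ?v s) 1 ?s2"
    using exec.Move[of ?b "2 * i + 2" "set_reg ?a ?v s"] assms by simp
  then have "exec (Seq (Move ?a (2 * j + 2)) (Seq (Move ?b (2 * i + 2)) (Seq ?loop (Load ?a ?a)))) s
     (1 + (1 + ((3 * ?u + 1) + 1))) ?s3"
    by (intro exec.Seq[OF exec.Move] exec.Seq[of _ _ 1 ?s2] exec.Seq[OF s'(1)] exec.Load)
  \<comment> \<open>Since \<open>?v < n\<close>, the address \<open>?v + ?u * n\<close> decomposes
    under \<open>div\<close> and \<open>mod\<close> by \<open>n\<close> into \<open>?u\<close> and
    \<open>?v\<close>.\<close>
  moreover have "mem s' (?v + ?u * n) = (if E ?u ?v then 1 else 0)"
    using s(1) s'(2) uv by (simp add: represents_def)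
  ultimately show "\<exists>t s'. exec (Seq (Move ?a (2 * j + 2)) (Seq (Move ?b (2 * i + 2)) (Seq ?loop (Load ?a ?a)))) s t s' \<and>
     t \<le> poly [:4, 3:] n \<and> mem s' = mem s \<and>
        (\<forall>r < 2 * d + 2. reg s' r = reg s r) \<and>
        reg s' (2 * d + 2) = (if E (env d s ! i) (env d s ! j) then 1 else 0)"
    using s' assms uv by - (rule exec_witness, assumption, auto)
qed

section \<open>Vertex quantifiers\<close>

text \<open>A loop tries the vertices from \<open>n - 1\<close> down to \<open>0\<close>. The
  candidate is kept in \<open>?x\<close>, the register of variable \<open>d\<close>. This register
  and the flag \<open>?f\<close> lie below the answer register \<open>?y\<close> of the body, so the
  body preserves both. At most \<open>n\<close> rounds keep the time polynomial.\<close>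

lemma fo_decidable_ex:
  assumes "fo_decidable (Suc d) P"
  shows "fo_decidable d (\<lambda>n E e. \<exists>x<n. P n E (e @ [x]))"
proof -
  obtain c q where c: "decided_by c q (Suc d) P"
    using assms by (auto simp: fo_decidable_def)
  let ?x = "2 * d + 2"
  let ?f = "2 * d + 3"
  let ?y = "2 * d + 4"
  let ?body = "Seq (Sub ?x ?x 1) (Seq c (IfNonzero ?y (Move ?f 1) Skip))"
  \<comment> \<open>The claim is about an arbitrary intermediate state, so that induction on the
    number \<open>m\<close> of untested candidates applies: the flag records a success so far, the
    other disjunct stands for the candidates below \<open>m\<close>.\<close>
  have loop: "\<exists>t s'. exec (WhileNonzero ?x ?body) s t s' \<and> t \<le> m * (poly q n + 4) + 1 \<and> mem s' = mem s \<and>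
        (\<forall>r < 2 * d + 2. reg s' r = reg s r) \<and>
        reg s' ?f = (if reg s ?f = 1 \<or> (\<exists>x<m. P n E (env d s @ [x])) then 1 else 0)"
    if "represents n E s" "set (env d s) \<subseteq> {..<n}" "reg s ?x = m" "m \<le> n" "reg s ?f \<le> 1" for n E s m
    using that
  proof (induction m arbitrary: s)
    case 0
    then have "exec (WhileNonzero ?x ?body) s 1 s"
      by (intro exec.WhileFalse)
    with 0 show ?case by (intro exI[of _ 1] exI[of _ s]) auto
  next
    case (Suc m)
    let ?s1 = "set_reg ?x (reg s ?x - reg s 1) s"
    have x: "reg ?s1 ?x = m"
      using Suc.prems by (simp add: represents_def)
    have 1: "represents n E ?s1" "env d ?s1 = env d s"
      using Suc.prems represents_cong[of n E s ?s1 d] env_cong[of d ?s1 s] by auto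
    have e: "env (Suc d) ?s1 = env d s @ [m]"
      using 1 x by (simp add: env_Suc)
    have "set (env (Suc d) ?s1) \<subseteq> {..<n}"
      using Suc.prems e by simp
    have "2 * Suc d + 2 = 2 * d + 4"
      by simp
    from decided_byD[OF c 1(1) \<open>set (env (Suc d) ?s1) \<subseteq> {..<n}\<close>]
    have "\<exists>t s'. exec c ?s1 t s' \<and> t \<le> poly q n \<and> mem s' = mem ?s1 \<and>
        (\<forall>r < 2 * d + 4. reg s' r = reg ?s1 r) \<and>
        reg s' ?y = (if P n E (env d s @ [m]) then 1 else 0)"
      unfolding e \<open>2 * Suc d + 2 = 2 * d + 4\<close> .
    then obtain t s2 where t: "exec c ?s1 t s2" "t \<le> poly q n" "mem s2 = mem ?s1"
      "\<forall>r < 2 * d + 4. reg s2 r = reg ?s1 r"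
      "reg s2 ?y = (if P n E (env d s @ [m]) then 1 else 0)"
      by blast
    define s3 where "s3 = (if P n E (env d s @ [m]) then set_reg ?f (reg s2 1) s2 else s2)"
    have "exec (IfNonzero ?y (Move ?f 1) Skip) s2 (1 + 1) s3"
      using t(5) s3_def exec.IfTrue[OF _ exec.Move] exec.IfFalse[OF _ exec.Skip] by simp
    then have body: "exec ?body s (1 + (t + (1 + 1))) s3"
      using t(1) by (intro exec.Seq[OF exec.Sub] exec.Seq)
    have one: "reg s2 1 = 1" "reg s 1 = 1"
      using t(4) Suc.prems(1) by (auto simp: represents_def)
    have 3: "mem s3 = mem s" "\<forall>r < 2 * d + 2. reg s3 r = reg s r" "reg s3 ?x = m"
      "reg s3 ?f = (if reg s ?f = 1 \<or> P n E (env d s @ [m]) then 1 else 0)"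
      using t one x Suc.prems unfolding s3_def by auto
    have 4: "represents n E s3" "env d s3 = env d s"
      using 3 Suc.prems represents_cong[of n E s s3 d] env_cong[of d s3 s] by auto
    have 5: "set (env d s3) \<subseteq> {..<n}" "m \<le> n" "reg s3 ?f \<le> 1"
      using Suc.prems(2,4) 3(4) 4(2) by auto
    obtain t' s' where t': "exec (WhileNonzero ?x ?body) s3 t' s'" "t' \<le> m * (poly q n + 4) + 1"
      "mem s' = mem s3" "\<forall>r < 2 * d + 2. reg s' r = reg s3 r"
      "reg s' ?f = (if reg s3 ?f = 1 \<or> (\<exists>x<m. P n E (env d s @ [x])) then 1 else 0)"
      using Suc.IH[OF 4(1) 5(1) 3(3) 5(2,3)] unfolding 4(2) by blast
    have "exec (WhileNonzero ?x ?body) s ((1 + (t + (1 + 1))) + t' + 1) s'"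
      using Suc.prems by (intro exec.WhileTrue[OF _ body t'(1)]) simp
    moreover have "(1 + (t + (1 + 1))) + t' + 1 \<le> Suc m * (poly q n + 4) + 1"
      using t(2) t'(2) by simp
    ultimately show ?case
      using t' 3 by - (rule exec_witness, assumption, auto simp: less_Suc_eq)
  qed
  show ?thesis
  proof (rule decidedI)
    fix n E s
    assume s: "represents n E s" "set (env d s) \<subseteq> {..<n}"
    let ?s1 = "set_reg ?x (reg s 0) s"
    let ?s2 = "set_reg ?f 0 ?s1"
    have 2: "represents n E ?s2" "env d ?s2 = env d s"
      using s represents_cong[of n E s ?s2 d] env_cong[of d ?s2 s] by auto
    have 3: "reg ?s2 ?x = n" "reg ?s2 ?f = 0" "mem ?s2 = mem s" "\<forall>r < 2 * d + 2. reg ?s2 r = reg s r"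
      using s(1) by (auto simp: represents_def)
    obtain t s' where t: "exec (WhileNonzero ?x ?body) ?s2 t s'" "t \<le> n * (poly q n + 4) + 1"
      "mem s' = mem s" "\<forall>r < 2 * d + 2. reg s' r = reg s r"
      "reg s' ?f = (if (\<exists>x<n. P n E (env d s @ [x])) then 1 else 0)"
      using loop[of n E ?s2 n] s 2 3 by auto
    have "exec (Seq (Move ?x 0) (Seq (Const ?f 0) (Seq (WhileNonzero ?x ?body) (Move ?x ?f)))) s
       (1 + (1 + (t + 1))) (set_reg ?x (reg s' ?f) s')"
      by (intro exec.Seq[OF exec.Move] exec.Seq[OF exec.Const] exec.Seq[OF t(1)] exec.Move)
    then show "\<exists>t s'. exec (Seq (Move ?x 0) (Seq (Const ?f 0) (Seq (WhileNonzero ?x ?body) (Move ?x ?f)))) s t s' \<and>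
     t \<le> poly ([:0, 1:] * (q + 4) + 4) n \<and> mem s' = mem s \<and>
        (\<forall>r < 2 * d + 2. reg s' r = reg s r) \<and>
        reg s' (2 * d + 2) = (if \<exists>x<n. P n E (env d s @ [x]) then 1 else 0)"
      using t by - (rule exec_witness, assumption, auto)
  qed
qed

lemma fo_decidable_all:
  assumes "fo_decidable (Suc d) P"
  shows "fo_decidable d (\<lambda>n E e. \<forall>x<n. P n E (e @ [x]))"
  using fo_decidable_not[OF fo_decidable_ex[OF fo_decidable_not[OF assms]]] by simp

text \<open>A quantifier over lists of fixed length \<open>m\<close> amounts to \<open>m\<close>
  nested vertex quantifiers; the entries become the variables \<open>d\<close> to
  \<open>d + m - 1\<close>.\<close>

lemma fo_decidable_ex_list:
  assumes "fo_decidable (d + m) P"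
  shows "fo_decidable d (\<lambda>n E e. \<exists>xs. length xs = m \<and> set xs \<subseteq> {..<n} \<and> P n E (e @ xs))"
  using assms
proof (induction m arbitrary: d)
  case 0
  then show ?case by simp
next
  case (Suc m)
  then have "fo_decidable (Suc d) (\<lambda>n E e. \<exists>xs. length xs = m \<and> set xs \<subseteq> {..<n} \<and> P n E (e @ xs))"
    by simp
  from fo_decidable_ex[OF this] show ?case
    by (rule fo_decidable_cong) (force simp: length_Suc_conv)
qed

lemma fo_decidable_all_list:
  assumes "fo_decidable (d + m) P"
  shows "fo_decidable d (\<lambda>n E e. \<forall>xs. length xs = m \<longrightarrow> set xs \<subseteq> {..<n} \<longrightarrow> P n E (e @ xs))"
  using fo_decidable_not[OF fo_decidable_ex_list[OF fo_decidable_not[OF assms]]] by (simp add: imp_conjL[symmetric] conj_commute)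

section \<open>From closed formulas to decision programs\<close>

lemma decides_in_poly_timeI:
  assumes "fo_decidable 0 P"
    and "\<And>n G. \<lbrakk>pair_graph G; pverts G = {..<n}; C G\<rbrakk> \<Longrightarrow>
       Q G \<longleftrightarrow> P n (\<lambda>u v. (u, v) \<in> parcs G) []"
  shows "\<exists>c. decides_in_poly_time c C Q"
proof -
  obtain c q where c: "decided_by c q 0 P"
    using assms by (auto simp: fo_decidable_def)
  \<comment> \<open>Register \<open>1\<close> is first set to \<open>1\<close>, as
    \<open>represents\<close> demands. Without free variables the answer appears in register
    \<open>2\<close>, from where it is moved to register \<open>0\<close>.\<close>
  have "decides_in_poly_time (Seq (Const 1 1) (Seq c (Move 0 2))) C Q"
    unfolding decides_in_poly_time_def
  proof (intro exI[of _ "q + 2"] allI impI)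
    fix n G
    assume G: "pair_graph G \<and> pverts G = {..<n} \<and> C G"
    let ?s = "set_reg 1 1 (input_state n G)"
    have "represents n (\<lambda>u v. (u, v) \<in> parcs G) ?s" "env 0 ?s = []"
      by (auto simp: represents_def input_state_def env_def)
    then obtain t s' where t: "exec c ?s t s'" "t \<le> poly q n"
      "reg s' (2 * 0 + 2) = (if P n (\<lambda>u v. (u, v) \<in> parcs G) [] then 1 else 0)"
      using decided_byD[OF c, of n "\<lambda>u v. (u, v) \<in> parcs G" ?s] by (metis empty_subsetI list.set(1))
    have "exec (Seq (Const 1 1) (Seq c (Move 0 2))) (input_state n G) (1 + (t + 1)) (set_reg 0 (reg s' 2) s')"
      by (intro exec.Seq[OF exec.Const] exec.Seq[OF t(1)] exec.Move)
    then show "\<exists>t s. exec (Seq (Const 1 1) (Seq c (Move 0 2))) (input_state n G) t s \<and>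
       t \<le> poly (q + 2) n \<and> reg s 0 = (if Q G then 1 else 0)"
      using t G assms(2)[of G n] by - (rule exec_witness, assumption, auto simp: numeral_2_eq_2)
  qed
  then show ?thesis by blast
qed

section \<open>Graphs of bounded independence number\<close>

text \<open>Bounds the separator after \<open>j\<close> refinements. Skeletons for a separator of
  size \<open>s\<close> can be shortened to \<open>3 * s + 2\<close> vertices, and each of these may
  cost a connecting path of up to \<open>2 * k\<close> further vertices. The product is the
  connectivity demanded, and a refinement adds at most that many vertices.\<close>

primrec separator_bound :: "nat \<Rightarrow> nat \<Rightarrow> nat" where
  "separator_bound k 0 = 0"
| "separator_bound k (Suc j) = separator_bound k j + (3 * separator_bound k j + 2) * (2 * k + 1)"

lemma not_successively_split:
  assumes "\<not> successively P xs"
  obtains as x y bs where "xs = as @ x # y # bs" "\<not> P x y"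
proof -
  obtain i where i: "Suc i < length xs" "\<not> P (xs ! i) (xs ! Suc i)"
    using assms by (auto simp: successively_conv_nth)
  have "xs = take i xs @ xs ! i # xs ! Suc i # drop (Suc (Suc i)) xs"
    using i(1) by (metis Cons_nth_drop_Suc Suc_lessD append_take_drop_id)
  with i(2) that show thesis by blast
qed

text \<open>Pigeonhole: \<open>s + 1\<close> fibers with at most \<open>k\<close> elements each hold
  at most \<open>(s + 1) * k\<close> elements.\<close>

lemma large_fiber:
  assumes "finite P" "f ` P \<subseteq> {..s}" "(s + 1) * k < card P"
  obtains t where "k < card {i \<in> P. f i = t}"
proof -
  have "\<exists>t. k < card {i \<in> P. f i = t}"
  proof (rule ccontr)
    assume *: "\<nexists>t. k < card {i \<in> P. f i = t}"
    have "card P = card (\<Union>t\<in>{..s}. {i \<in> P. f i = t})"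
      using assms(2) by (intro arg_cong[where f = card]) auto
    also have "\<dots> \<le> (\<Sum>t\<in>{..s}. card {i \<in> P. f i = t})"
      by (rule card_UN_le) simp
    also have "\<dots> \<le> (\<Sum>t\<in>{..s}. k)"
      using * by (intro sum_mono) (simp add: not_less)
    finally show False
      using assms(3) by simp
  qed
  then show thesis using that by blast
qed

locale bounded_independence =
  fixes V :: "'a set" and E :: "'a \<Rightarrow> 'a \<Rightarrow> bool" and k :: nat
  assumes finite_V: "finite V"
    and sym: "E x y \<Longrightarrow> E y x"
    and irrefl: "\<not> E x x"
    and no_independent: "\<lbrakk>I \<subseteq> V; card I = k\<rbrakk> \<Longrightarrow> \<exists>x\<in>I. \<exists>y\<in>I. E x y"
begin

section \<open>Reachability after deleting a vertex set\<close>

definition walk :: "'a set \<Rightarrow> 'a \<Rightarrow> 'a list \<Rightarrow> 'a \<Rightarrow> bool" where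
  "walk S u q v \<longleftrightarrow> q \<noteq> [] \<and> hd q = u \<and> last q = v \<and> set q \<subseteq> V - S \<and> successively E q"

definition reach :: "'a set \<Rightarrow> 'a \<Rightarrow> 'a \<Rightarrow> bool" where
  "reach S u v \<longleftrightarrow> (\<exists>q. walk S u q v)"

lemma reach_refl: "u \<in> V - S \<Longrightarrow> reach S u u"
  unfolding reach_def walk_def by (intro exI[of _ "[u]"]) auto

lemma reach_mem: "reach S u v \<Longrightarrow> u \<in> V - S \<and> v \<in> V - S"
  unfolding reach_def walk_def by (metis hd_in_set last_in_set subsetD)

lemma successively_sym: "successively (\<lambda>x y. E y x) q \<longleftrightarrow> successively E q"
  using sym by (metis (no_types, lifting) successively_mono)

lemma reach_sym: "reach S u v \<Longrightarrow> reach S v u"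
  unfolding reach_def walk_def
  by (metis hd_rev last_rev rev_is_Nil_conv set_rev successively_rev successively_sym)

lemma reach_step:
  assumes "reach S u v" "E v w" "w \<in> V - S"
  shows "reach S u w"
proof -
  obtain q where "walk S u q v"
    using assms(1) reach_def by blast
  then have "walk S u (q @ [w]) w"
    using assms by (auto simp: walk_def successively_append_iff)
  then show ?thesis using reach_def by blast
qed

lemma reach_trans:
  assumes "reach S u v" "reach S v w"
  shows "reach S u w"
proof -
  obtain q q' where q: "walk S u q v" "walk S v q' w"
    using assms reach_def by blast
  then obtain r where "q' = v # r"
    by (auto simp: walk_def neq_Nil_conv)
  with q have "walk S u (q @ r) w"
    by (cases r) (auto simp: walk_def successively_append_iff successively_Cons)
  then show ?thesis using reach_def by blast
qed

lemma reach_induct: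
  assumes "reach S u v" "u \<in> Y" "\<And>x y. \<lbrakk>x \<in> Y; y \<in> V - S; E x y\<rbrakk> \<Longrightarrow> y \<in> Y"
  shows "v \<in> Y"
proof -
  obtain q where "walk S u q v"
    using assms(1) reach_def by blast
  then have "q \<noteq> []" "hd q \<in> Y" "successively E q" "set q \<subseteq> V - S" "last q = v"
    using assms(2) by (auto simp: walk_def)
  then show "v \<in> Y"
  proof (induction q)
    case (Cons x q)
    then show ?case
      using assms(3)[of x "hd q"] by (cases q) auto
  qed simp
qed

lemma reach_antimono:
  assumes "reach T u v" "S \<subseteq> T"
  shows "reach S u v"
  using assms unfolding reach_def walk_def by blast

text \<open>A shortest walk is an induced path; every second vertex of it is independent.\<close>

lemma reach_short:
  assumes "reach S u v"
  obtains q where "walk S u q v" "distinct q" "length q < 2 * k"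
proof -
  obtain q where q: "walk S u q v" and min: "\<And>r. walk S u r v \<Longrightarrow> length q \<le> length r"
    using assms ex_has_least_nat[of "\<lambda>q. walk S u q v" _ length] unfolding reach_def by blast
  have nowalk: "\<not> walk S u (take i q @ drop j q) v" if "i < j" "j < length q" for i j
    using min[of "take i q @ drop j q"] that by auto
  have hd: "hd q = u" "last q = v" "set q \<subseteq> V - S" "successively E q" "q \<noteq> []"
    using q by (auto simp: walk_def)
  \<comment> \<open>Positions \<open>i\<close> to \<open>j - 1\<close> can be cut out whenever
    \<open>q ! j\<close> can take the place of \<open>q ! i\<close>. Minimality forbids this, which
    excludes both repeated vertices (\<open>dist\<close>) and chords
    (\<open>nonadj\<close>).\<close>
  have short: "walk S u (take i q @ drop j q) v"
    if ij: "i < j" "j < length q" "i = 0 \<longrightarrow> q ! j = u" "i > 0 \<longrightarrow> E (q ! (i - 1)) (q ! j)" for i j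
  proof -
    have "successively E (take i q)" "successively E (drop j q)"
      using hd(4) by (metis append_take_drop_id successively_append_iff)+
    moreover have "last (take i q) = q ! (i - 1)" if "i > 0"
      using ij(1,2) \<open>i > 0\<close> by (subst last_conv_nth) (auto simp: min_def)
    moreover have "hd (take i q @ drop j q) = u"
      using ij(1-3) hd(1) by (cases "i = 0") (auto simp: hd_drop_conv_nth hd_append)
    moreover have "set (take i q @ drop j q) \<subseteq> V - S"
      using hd(3) set_take_subset[of i q] set_drop_subset[of j q] by auto
    moreover have "last (take i q @ drop j q) = v" "drop j q \<noteq> []" "hd (drop j q) = q ! j"
      using ij(2) hd(2) by (simp_all add: hd_drop_conv_nth)
    ultimately show ?thesis
      using ij(4) unfolding walk_def successively_append_iff by (cases "i = 0") simp_all
  qed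
  have dist: "q ! i \<noteq> q ! j" if "i < j" "j < length q" for i j
  proof
    assume eq: "q ! i = q ! j"
    have "E (q ! (i - 1)) (q ! i)" if "i > 0"
      using successively_nth[OF hd(4), of "i - 1"] that \<open>i < j\<close> \<open>j < length q\<close> by simp
    moreover have "q ! 0 = u"
      using hd by (simp add: hd_conv_nth)
    ultimately show False
      using short[OF that] nowalk[OF that] eq by (cases "i = 0") simp_all
  qed
  have nonadj: "\<not> E (q ! i) (q ! j)" if "Suc i < j" "j < length q" for i j
    using short[OF that] nowalk[OF that] by auto
  have "distinct q"
    using dist by (metis distinct_conv_nth linorder_neqE_nat)
  moreover have "length q < 2 * k"
  proof (rule ccontr)
    assume "\<not> length q < 2 * k"
    then have len: "2 * i < length q" if "i < k" for i
      using that by linarith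
    let ?I = "(\<lambda>i. q ! (2 * i)) ` {..<k}"
    have "inj_on (\<lambda>i. q ! (2 * i)) {..<k}"
      using \<open>distinct q\<close> len by (auto simp: inj_on_def nth_eq_iff_index_eq)
    then have "card ?I = k"
      by (simp add: card_image)
    moreover have "?I \<subseteq> V"
      using len hd(3) by (auto intro!: subsetD[OF hd(3), THEN DiffD1])
    ultimately obtain i j where "i < k" "j < k" "E (q ! (2 * i)) (q ! (2 * j))"
      using no_independent[of ?I] by auto
    then show False
    proof (cases i j rule: linorder_cases)
      case less
      then show False
        using nonadj[of "2 * i" "2 * j"] len[OF \<open>j < k\<close>] \<open>E (q ! (2 * i)) (q ! (2 * j))\<close> by simp
    next
      case equal
      then show False
        using irrefl \<open>E (q ! (2 * i)) (q ! (2 * j))\<close> by simp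
    next
      case greater
      then show False
        using nonadj[of "2 * j" "2 * i"] len[OF \<open>i < k\<close>] sym[OF \<open>E (q ! (2 * i)) (q ! (2 * j))\<close>] by simp
    qed
  qed
  ultimately show thesis using that q by blast
qed

section \<open>Skeletons of Hamiltonian paths\<close>

text \<open>
  The shadow of a Hamiltonian path on a small set \<open>S\<close>: two consecutive vertices outside \<open>S\<close> stand
  for a segment of the path in one component of \<open>G - S\<close>, and every remaining vertex lies in a
  component through which such a segment runs.
\<close>

definition link :: "'a set \<Rightarrow> 'a \<Rightarrow> 'a \<Rightarrow> bool" where
  "link S x y \<longleftrightarrow> (if x \<in> S \<or> y \<in> S then E x y else reach S x y)"

definition misses :: "'a set \<Rightarrow> 'a \<Rightarrow> 'a \<Rightarrow> 'a \<Rightarrow> bool" where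
  "misses S v x y \<longleftrightarrow> x \<in> S \<or> y \<in> S \<or> \<not> reach S v x"

definition skeleton :: "'a set \<Rightarrow> 'a list \<Rightarrow> bool" where
  "skeleton S w \<longleftrightarrow> distinct w \<and> w \<noteq> [] \<and> S \<subseteq> set w \<and> set w \<subseteq> V \<and> successively (link S) w \<and>
     (\<forall>v\<in>V - set w. \<not> successively (misses S v) w)"

text \<open>This is a connectivity condition on all components of \<open>G - S\<close> at once. A
  component with at most \<open>c + 2\<close> vertices must be complete, since all its vertices but
  two may be deleted.\<close>

definition highly_connected :: "nat \<Rightarrow> 'a set \<Rightarrow> bool" where
  "highly_connected c S \<longleftrightarrow> (\<forall>X u v. finite X \<and> card X \<le> c \<and> reach S u v \<and> u \<notin> X \<and> v \<notin> X \<longrightarrow> reach (S \<union> X) u v)"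

lemma edge_link:
  assumes "E x y" "x \<in> V" "y \<in> V"
  shows "link S x y"
  using assms reach_step[OF reach_refl] by (auto simp: link_def)

lemma path_link:
  assumes "successively E q" "set q \<subseteq> V"
  shows "successively (link S) q"
  using assms edge_link by (metis (mono_tags, lifting) subsetD successively_mono)

text \<open>The covering condition is vacuous, as no vertex lies outside \<open>p\<close>.\<close>

lemma hamiltonian_path_skeleton:
  assumes "distinct p" "p \<noteq> []" "set p = V" "S \<subseteq> V" "successively E p"
  shows "skeleton S p"
  using assms path_link[of p S] by (auto simp: skeleton_def)

text \<open>The \<open>s\<close> vertices of \<open>S\<close> on \<open>w\<close> leave at most
  \<open>s + 1\<close> runs outside \<open>S\<close>, each with at most two vertices, and
  \<open>s + 2 * (s + 1) = 3 * s + 2\<close>.\<close>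

lemma no_three_length:
  assumes "distinct w" "\<And>xs x y z ys. w = xs @ x # y # z # ys \<Longrightarrow> x \<in> S \<or> y \<in> S \<or> z \<in> S"
  shows "length w \<le> 3 * length (filter (\<lambda>x. x \<in> S) w) + 2"
  using assms
proof (induction w rule: length_induct)
  case (1 w)
  have drop: "length r \<le> 3 * length (filter (\<lambda>x. x \<in> S) r) + 2"
    if "w = q @ r" "q \<noteq> []" for q r
  proof -
    have "length r < length w" "distinct r"
      using that 1(2) by auto
    moreover have "x \<in> S \<or> y \<in> S \<or> z \<in> S" if "r = xs @ x # y # z # ys" for xs x y z ys
      using 1(3)[of "q @ xs" x y z ys] \<open>w = q @ r\<close> that by simp
    ultimately show ?thesis
      using 1(1) by blast
  qed
  show ?case
  proof (cases "length w \<le> 2")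
    case False
    then have "Suc (Suc (Suc 0)) \<le> length w"
      by simp
    then obtain x y z r where w: "w = x # y # z # r"
      by (auto simp: Suc_le_length_iff)
    then consider "x \<in> S" | "y \<in> S" | "z \<in> S"
      using 1(3)[of "[]" x y z r] by auto
    then show ?thesis
    proof cases
      case 1 with w drop[of "[x]" "y # z # r"] show ?thesis by auto
    next
      case 2 with w drop[of "[x, y]" "z # r"] show ?thesis by auto
    next
      case 3 with w drop[of "[x, y, z]" r] show ?thesis by auto
    qed
  qed auto
qed

text \<open>The three vertices lie in one component of \<open>G - S\<close>, so \<open>x\<close> and
  \<open>z\<close> stay linked. Whatever was covered through \<open>y\<close> is covered through
  \<open>x\<close>, and so is \<open>y\<close> itself.\<close>

lemma skeleton_delete:
  assumes "skeleton S (xs @ x # y # z # ys)" "x \<notin> S" "y \<notin> S" "z \<notin> S"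
  shows "skeleton S (xs @ x # z # ys)"
proof -
  have l: "reach S x y" "reach S y z"
    using assms by (auto simp: skeleton_def successively_append_iff link_def)
  then have "link S x z"
    using assms reach_trans by (auto simp: link_def)
  moreover have "\<not> successively (misses S v) (xs @ x # z # ys)" if "v \<in> V - set (xs @ x # z # ys)" for v
  proof (cases "v = y")
    case True
    then show ?thesis using l reach_sym assms by (auto simp: successively_append_iff misses_def)
  next
    case False
    then have "\<not> successively (misses S v) (xs @ x # y # z # ys)"
      using assms that by (auto simp: skeleton_def)
    moreover have "reach S v x" if "reach S v y"
      using that l reach_trans reach_sym by blast
    ultimately show ?thesis using assms by (auto simp: successively_append_iff misses_def)
  qed
  ultimately show ?thesis
    using assms by (auto simp: skeleton_def successively_append_iff successively_Cons)
qed

text \<open>In a shortest skeleton with the ends of \<open>p\<close>, no three consecutive vertices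
  avoid \<open>S\<close>, since the middle one could be deleted.\<close>

lemma skeleton_shorten:
  assumes "skeleton S p"
  obtains w where "skeleton S w" "hd w = hd p" "last w = last p" "length w \<le> 3 * card S + 2"
proof -
  let ?P = "\<lambda>w. skeleton S w \<and> hd w = hd p \<and> last w = last p"
  obtain w where w: "?P w" and min: "\<And>r. ?P r \<Longrightarrow> length w \<le> length r"
    using assms ex_has_least_nat[of ?P p length] by blast
  have "x \<in> S \<or> y \<in> S \<or> z \<in> S" if "w = xs @ x # y # z # ys" for xs x y z ys
  proof (rule ccontr)
    assume "\<not> (x \<in> S \<or> y \<in> S \<or> z \<in> S)"
    then have "?P (xs @ x # z # ys)"
      using w that skeleton_delete[of S xs x y z ys] by (cases xs) auto
    from min[OF this] that show False by simp
  qed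
  then have "length w \<le> 3 * length (filter (\<lambda>x. x \<in> S) w) + 2"
    using w by (intro no_three_length) (auto simp: skeleton_def)
  moreover have "length (filter (\<lambda>x. x \<in> S) w) = card S"
  proof -
    have "distinct (filter (\<lambda>x. x \<in> S) w)" "set (filter (\<lambda>x. x \<in> S) w) = S"
      using w by (auto simp: skeleton_def)
    then show ?thesis by (metis distinct_card)
  qed
  ultimately show thesis using that[of w] w by simp
qed

text \<open>The path \<open>m\<close> avoids the skeleton and hence \<open>S\<close>. Vertices
  covered through the pair \<open>u\<close>, \<open>v\<close> are now covered through
  \<open>u\<close> and its new successor, both of which are outside \<open>S\<close>.\<close>

lemma skeleton_insert:
  assumes "skeleton S (xs @ u # v # ys)" "distinct m" "set m \<subseteq> V - set (xs @ u # v # ys)"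
    "successively E (u # m @ [v])" "u \<notin> S" "v \<notin> S"
  shows "skeleton S (xs @ u # m @ v # ys)"
proof -
  let ?w = "xs @ u # v # ys"
  let ?w' = "xs @ u # m @ v # ys"
  have sk: "distinct ?w" "S \<subseteq> set ?w" "set ?w \<subseteq> V" "successively (link S) ?w"
    "\<And>z. z \<in> V - set ?w \<Longrightarrow> \<not> successively (misses S z) ?w"
    using assms(1) by (auto simp: skeleton_def)
  have "successively (link S) (u # m @ [v])"
    using sk assms by (intro path_link) auto
  then have "successively (link S) ?w'"
    using sk(4) by (cases m) (auto simp: successively_append_iff successively_Cons hd_append)
  moreover have "\<not> successively (misses S z) ?w'" if "z \<in> V - set ?w'" for z
  proof -
    have "\<not> successively (misses S z) ?w"
      using sk(5) that by simp
    moreover have "m \<noteq> [] \<Longrightarrow> hd m \<notin> S"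
      using assms sk hd_in_set[of m] by blast
    ultimately show ?thesis
      using assms(5,6) by (cases m) (auto simp: successively_append_iff successively_Cons misses_def)
  qed
  ultimately show ?thesis
    using sk assms by (auto simp: skeleton_def)
qed

section \<open>Realizing a skeleton by a path\<close>

text \<open>\<open>xs\<close> is the part already realized and \<open>ys\<close> the part to come. A
  step moves one vertex from \<open>ys\<close> to \<open>xs\<close> and adds fewer than
  \<open>2 * k\<close> others, so \<open>length (xs @ ys) + 2 * k * length ys\<close> does not grow
  and \<open>c\<close> stays large enough.\<close>

lemma skeleton_realize:
  assumes "skeleton S (xs @ ys)" "successively E xs" "xs \<noteq> []" "highly_connected c S"
    "length (xs @ ys) + 2 * k * length ys \<le> c"
  shows "\<exists>p. skeleton S p \<and> successively E p \<and> hd p = hd (xs @ ys) \<and> last p = last (xs @ ys)"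
  using assms
proof (induction ys arbitrary: xs)
  case Nil
  then show ?case by auto
next
  case (Cons y ys)
  obtain zs u where xs: "xs = zs @ [u]"
    using Cons.prems(3) by (metis rev_exhaust)
  show ?case
  proof (cases "E u y")
    case True
    then have "\<exists>p. skeleton S p \<and> successively E p \<and> hd p = hd ((xs @ [y]) @ ys) \<and>
        last p = last ((xs @ [y]) @ ys)"
      using Cons.prems xs by (intro Cons.IH) (simp_all add: successively_append_iff)
    then show ?thesis
      by simp
  next
    case False
    let ?w = "zs @ u # y # ys"
    have sk: "skeleton S ?w"
      using Cons.prems xs by simp
    then have l: "u \<notin> S" "y \<notin> S" "reach S u y"
      using False by (auto simp: skeleton_def successively_append_iff link_def split: if_splits)
    let ?X = "set ?w - {u, y}"
    have "card ?X \<le> card (set ?w)"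
      by (intro card_mono) auto
    also have "\<dots> \<le> c"
      using card_length[of ?w] Cons.prems(5) xs by simp
    finally have "reach (S \<union> ?X) u y"
      using Cons.prems(4) l unfolding highly_connected_def by blast
    then obtain q where q: "walk (S \<union> ?X) u q y" "distinct q" "length q < 2 * k"
      using reach_short by blast
    moreover have "u \<noteq> y"
      using sk by (auto simp: skeleton_def)
    ultimately obtain m where m: "q = u # m @ [y]"
      unfolding walk_def
      by (metis append_butlast_last_id hd_Cons_tl last_ConsL last_ConsR)
    have "S \<subseteq> set ?w"
      using sk by (auto simp: skeleton_def)
    then have m': "distinct m" "set m \<subseteq> V - set ?w" "successively E (u # m @ [y])"
      using q m unfolding walk_def by auto
    then have "skeleton S (zs @ u # m @ y # ys)"
      using skeleton_insert sk l by blast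
    moreover have "successively E (xs @ m @ [y])"
      using m'(3) Cons.prems(2) xs by (auto simp: successively_append_iff successively_Cons)
    moreover have "length ((xs @ m @ [y]) @ ys) + 2 * k * length ys \<le> c"
      using Cons.prems(5) q(3) m by simp
    ultimately have "\<exists>p. skeleton S p \<and> successively E p \<and> hd p = hd ((xs @ m @ [y]) @ ys) \<and>
        last p = last ((xs @ m @ [y]) @ ys)"
      using Cons.prems(4) xs by (intro Cons.IH) simp_all
    then show ?thesis
      using xs by (cases zs; cases ys) simp_all
  qed
qed

section \<open>Enlarging a path by insertion and rotation\<close>

lemma path_reach:
  assumes "successively E q" "set q \<subseteq> V - S" "x \<in> set q" "q \<noteq> []"
  shows "reach S (hd q) x"
proof -
  obtain as bs where q: "q = (as @ [x]) @ bs"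
    using split_list[OF assms(3)] by auto
  then have "walk S (hd q) (as @ [x]) x"
    using assms by (auto simp: walk_def successively_append_iff hd_append)
  then show ?thesis
    using reach_def by blast
qed

text \<open>The new path leaves \<open>x\<close> for the detour \<open>m\<close>, returns to the end
  of \<open>q\<close>, runs through \<open>q\<close> backwards and continues with \<open>bs\<close>.
  As \<open>x\<close> and \<open>q\<close> lie in one component of \<open>G - S\<close>, the pair
  \<open>x\<close>, \<open>hd m\<close> covers whatever was covered between \<open>x\<close> and
  \<open>bs\<close> before.\<close>

lemma skeleton_rotate:
  assumes sk: "skeleton S (as @ x # q @ bs)" and path: "successively E (as @ x # q @ bs)"
    and ne: "q \<noteq> []" "bs \<noteq> []" and S: "x \<notin> S" "set q \<inter> S = {}" "hd bs \<notin> S"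
    and m: "m \<noteq> []" "distinct m" "set m \<subseteq> V - set (as @ x # q @ bs)" "successively E m"
    and E: "E x (hd m)" "E (last m) (last q)" "E (hd q) (hd bs)"
  shows "skeleton S (as @ x # m @ rev q @ bs) \<and> successively E (as @ x # m @ rev q @ bs)"
proof -
  let ?w = "as @ x # q @ bs"
  let ?w' = "as @ x # m @ rev q @ bs"
  have sk': "distinct ?w" "S \<subseteq> set ?w" "set ?w \<subseteq> V"
    "\<And>z. z \<in> V - set ?w \<Longrightarrow> \<not> successively (misses S z) ?w"
    using sk by (auto simp: skeleton_def)
  have hl: "hd (m @ rev q @ bs) = hd m" "hd (rev q @ bs) = last q" "last (rev q) = hd q"
    "hd (q @ bs) = hd q"
    using m ne by (auto simp: hd_append hd_rev last_rev)
  have path': "successively E ?w'"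
    using path E m ne hl successively_sym[of q]
    by (simp add: successively_append_iff successively_Cons)
  have xq: "reach S x y" if "y \<in> set q" for y
  proof -
    have "successively E (x # q)"
      using path ne hl(4) by (auto simp: successively_append_iff successively_Cons)
    moreover have "set (x # q) \<subseteq> V - S"
      using sk'(3) S by auto
    ultimately show ?thesis
      using path_reach[of "x # q" S y] that by simp
  qed
  have "\<not> successively (misses S z) ?w'" if z: "z \<in> V - set ?w'" for z
  proof
    assume ms: "successively (misses S z) ?w'"
    have "hd m \<notin> S"
      using m sk' hd_in_set[of m] by blast
    moreover have "misses S z x (hd m)"
      using ms hl m by (simp add: successively_append_iff successively_Cons)
    ultimately have nx: "\<not> reach S z x"
      using S by (simp add: misses_def)
    then have nq: "\<not> reach S z y" if "y \<in> set q" for y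
      using xq[OF that] reach_trans reach_sym by blast
    have "successively E q"
      using path ne by (simp add: successively_append_iff successively_Cons)
    then have "successively (misses S z) q"
      by (rule successively_mono) (use nq in \<open>auto simp: misses_def\<close>)
    moreover have "misses S z x (hd q)" "misses S z (last q) (hd bs)"
      using nx nq ne by (auto simp: misses_def)
    ultimately have "successively (misses S z) ?w"
      using ms hl ne m by (simp add: successively_append_iff successively_Cons)
    moreover have "z \<in> V - set ?w"
      using z by auto
    ultimately show False
      using sk'(4) by blast
  qed
  moreover have "distinct ?w'" "S \<subseteq> set ?w'" "set ?w' \<subseteq> V"
    using sk' m by auto
  moreover have "successively (link S) ?w'"
    using path' \<open>set ?w' \<subseteq> V\<close> by (rule path_link)
  ultimately show ?thesis
    using path' by (auto simp: skeleton_def)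
qed

text \<open>
  The Chvatal-Erdos rotation. Here \<open>N\<close> will be the set of vertices of the path with a neighbour in
  a component of the uncovered part. Some segment of the path outside \<open>S\<close> contains more than \<open>k\<close> of
  them, so two of their successors are adjacent.
\<close>

lemma adjacent_successors:
  assumes "distinct p" "set p \<subseteq> V" "S \<subseteq> set p" "N \<subseteq> set p - S" "(card S + 1) * k < card N"
  obtains i j where "i < j" "Suc j < length p" "p ! i \<in> N" "p ! j \<in> N"
    "E (p ! Suc i) (p ! Suc j)" "\<And>r. \<lbrakk>i \<le> r; r \<le> Suc j\<rbrakk> \<Longrightarrow> p ! r \<notin> S"
proof -
  define P where "P = {i. i < length p \<and> p ! i \<in> N}"
  \<comment> \<open>\<open>f i\<close> counts the vertices of \<open>S\<close> before position
    \<open>i\<close>. Positions outside \<open>S\<close> with the same count lie in the same segment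
    of the path.\<close>
  define f where "f i = card (S \<inter> set (take i p))" for i
  have "finite S"
    using assms(2,3) finite_V finite_subset by blast
  have "N = (\<lambda>i. p ! i) ` P"
  proof (intro equalityI subsetI)
    fix x
    assume "x \<in> N"
    moreover from this obtain i where "i < length p" "x = p ! i"
      using assms(4) by (metis DiffD1 in_set_conv_nth subsetD)
    ultimately show "x \<in> (\<lambda>i. p ! i) ` P"
      by (auto simp: P_def)
  qed (auto simp: P_def)
  moreover have "inj_on (\<lambda>i. p ! i) P"
    using assms(1) by (auto simp: P_def inj_on_def nth_eq_iff_index_eq)
  ultimately have "card N = card P"
    by (simp add: card_image)
  moreover have "finite P"
    by (simp add: P_def)
  moreover have "f ` P \<subseteq> {..card S}"
    using \<open>finite S\<close> by (auto simp: f_def intro!: card_mono)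
  ultimately obtain t where "k < card {i \<in> P. f i = t}"
    using large_fiber assms(5) by metis
  define F where "F = {i \<in> P. f i = t}"
  define m where "m = Max F"
  have F: "finite F" "k < card F"
    using \<open>finite P\<close> \<open>k < card {i \<in> P. f i = t}\<close> by (auto simp: F_def)
  then have m: "m \<in> F" "\<And>i. i \<in> F \<Longrightarrow> i \<le> m"
    by (auto simp: m_def intro!: Max_in)
  \<comment> \<open>Leaving out the largest position \<open>m\<close> guarantees that the successors
    of the \<open>k\<close> chosen positions still lie in the segment.\<close>
  then have "k \<le> card (F - {m})"
    using F by simp
  then obtain T where T: "T \<subseteq> F - {m}" "card T = k"
    by (meson obtain_subset_with_card_n)
  have Tm: "i < m" if "i \<in> T" for i
    using T m(2)[of i] that by auto
  have mp: "m < length p"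
    using m by (auto simp: F_def P_def)
  \<comment> \<open>Equal counts at \<open>i\<close> and \<open>m\<close> leave no vertex of
    \<open>S\<close> in between, and \<open>p ! m\<close> is in \<open>N\<close>, hence outside
    \<open>S\<close>.\<close>
  have inS: "p ! r \<notin> S" if "i \<in> T" "i \<le> r" "r \<le> m" for i r
  proof
    assume r: "p ! r \<in> S"
    have "p ! m \<notin> S"
      using m assms(4) by (auto simp: F_def P_def)
    then have "r < m"
      using r that by (metis le_neq_implies_less)
    have "f i = f m"
      using that T m by (auto simp: F_def)
    moreover have "S \<inter> set (take i p) \<subseteq> S \<inter> set (take m p)"
      using that set_take_subset_set_take[of i m p] by auto
    ultimately have "S \<inter> set (take i p) = S \<inter> set (take m p)"
      using \<open>finite S\<close> by (intro card_subset_eq) (auto simp: f_def)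
    moreover have "p ! r \<in> set (take m p)"
      using \<open>r < m\<close> mp by (auto simp: in_set_conv_nth)
    ultimately have "p ! r \<in> set (take i p)"
      using r by blast
    then obtain l where "l < i" "p ! l = p ! r" "l < length p"
      by (auto simp: in_set_conv_nth)
    then show False
      using assms(1) that \<open>r < m\<close> mp by (auto simp: nth_eq_iff_index_eq)
  qed
  let ?I = "(\<lambda>i. p ! Suc i) ` T"
  have lT: "Suc i < length p" if "i \<in> T" for i
    using Tm[OF that] mp by simp
  then have "inj_on (\<lambda>i. p ! Suc i) T"
    using assms(1) by (auto simp: inj_on_def nth_eq_iff_index_eq)
  then have "card ?I = k"
    using T by (simp add: card_image)
  moreover have "?I \<subseteq> V"
    using lT assms(2) by auto
  ultimately obtain i j where ij: "i \<in> T" "j \<in> T" "E (p ! Suc i) (p ! Suc j)"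
    using no_independent[of ?I] by auto
  then have "i \<noteq> j"
    using irrefl by metis
  then obtain i j where ij: "i < j" "i \<in> T" "j \<in> T" "E (p ! Suc i) (p ! Suc j)"
    using ij sym by (metis linorder_neqE_nat)
  moreover have "p ! r \<notin> S" if "i \<le> r" "r \<le> Suc j" for r
    using inS[OF ij(2) that(1)] that(2) Tm[OF ij(3)] by simp
  moreover have "p ! i \<in> N" "p ! j \<in> N"
    using ij T by (auto simp: F_def P_def)
  ultimately show thesis
    using that lT by blast
qed

text \<open>If two consecutive path vertices lie in \<open>N\<close>, a detour through the uncovered
  component of \<open>v\<close> is inserted between them. Otherwise \<open>N\<close> has more than
  \<open>c\<close> vertices, and the rotation applies.\<close>

lemma skeleton_extend:
  assumes sk: "skeleton S p" and path: "successively E p" and g: "highly_connected c S"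
    and c: "(card S + 1) * k \<le> c" and v: "v \<in> V - set p"
  shows "\<exists>p'. skeleton S p' \<and> successively E p' \<and> hd p' = hd p \<and> last p' = last p \<and>
    length p < length p'"
proof -
  define N where "N = {x \<in> set p - S. \<exists>d. reach (set p) v d \<and> E x d}"
  have sk': "distinct p" "S \<subseteq> set p" "set p \<subseteq> V" "\<not> successively (misses S v) p"
    using sk v by (auto simp: skeleton_def)
  have connect: "\<exists>m. m \<noteq> [] \<and> distinct m \<and> set m \<subseteq> V - set p \<and> successively E m \<and>
      E x (hd m) \<and> E (last m) y" if xy: "x \<in> N" "y \<in> N" for x y
  proof -
    obtain d d' where d: "reach (set p) v d" "E x d" "reach (set p) v d'" "E y d'"
      using xy unfolding N_def by blast
    then have "reach (set p) d d'"
      using reach_sym reach_trans by blast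
    then obtain q where "walk (set p) d q d'" "distinct q"
      using reach_short by blast
    then show ?thesis
      using d sym by (intro exI[of _ q]) (auto simp: walk_def)
  qed
  show ?thesis
  proof (cases "\<exists>as x y bs. p = as @ x # y # bs \<and> x \<in> N \<and> y \<in> N")
    case True
    then obtain as x y bs where p: "p = as @ x # y # bs" and xy: "x \<in> N" "y \<in> N"
      by blast
    obtain m where m: "m \<noteq> []" "distinct m" "set m \<subseteq> V - set p" "successively E m"
      "E x (hd m)" "E (last m) y"
      using connect[OF xy] by blast
    have "successively E (x # m @ [y])"
      using m by (simp add: successively_append_iff successively_Cons)
    moreover have "x \<notin> S" "y \<notin> S"
      using xy by (auto simp: N_def)
    ultimately have "skeleton S (as @ x # m @ y # bs)"
      using sk m unfolding p by (intro skeleton_insert) auto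
    moreover have "successively E (as @ x # m @ y # bs)"
      using path m p by (simp add: successively_append_iff successively_Cons)
    ultimately show ?thesis
      using p m by (intro exI[of _ "as @ x # m @ y # bs"]) (cases as; simp)
  next
    case False
    obtain as x y bs where p: "p = as @ x # y # bs" and xy: "x \<notin> S" "y \<notin> S" "reach S v x"
      using not_successively_split[OF sk'(4)] unfolding misses_def by metis
    have "E x y"
      using path p by (simp add: successively_append_iff)
    then have "reach S v y"
      using xy sk' p by (intro reach_step[OF xy(3)]) auto
    \<comment> \<open>Not both of the consecutive vertices \<open>x\<close> and \<open>y\<close> are
      in \<open>N\<close>; \<open>z\<close> is one that is not.\<close>
    then obtain z where z: "z \<in> set p - S" "z \<notin> N" "reach S v z"
      using False p xy by (metis DiffI in_set_conv_decomp list.set_intros(1,2) Un_iff set_append)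
    \<comment> \<open>Otherwise some walk from \<open>v\<close> to \<open>z\<close> avoids
      \<open>S\<close> and \<open>N\<close>. It never leaves the uncovered part, because every path
      vertex adjacent to the component of \<open>v\<close> there is in \<open>S\<close> or
      \<open>N\<close>; but \<open>z\<close> is on the path.\<close>
    have "c < card N"
    proof (rule ccontr)
      assume "\<not> c < card N"
      moreover have "finite N" "v \<notin> N"
        using v by (auto simp: N_def)
      ultimately have "reach (S \<union> N) v z"
        using g z unfolding highly_connected_def by (meson not_less)
      then have "z \<in> {d. reach (set p) v d}"
      proof (rule reach_induct)
        show "v \<in> {d. reach (set p) v d}"
          using v reach_refl by blast
      next
        fix a b
        assume ab: "a \<in> {d. reach (set p) v d}" "b \<in> V - (S \<union> N)" "E a b"
        then have "b \<notin> set p"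
          using sym by (auto simp: N_def)
        then show "b \<in> {d. reach (set p) v d}"
          using ab reach_step by blast
      qed
      then show False
        using z reach_mem by blast
    qed
    then have "(card S + 1) * k < card N"
      using c by simp
    moreover have "N \<subseteq> set p - S"
      by (auto simp: N_def)
    ultimately obtain i j where ij: "i < j" "Suc j < length p" "p ! i \<in> N" "p ! j \<in> N"
        "E (p ! Suc i) (p ! Suc j)" "\<And>r. \<lbrakk>i \<le> r; r \<le> Suc j\<rbrakk> \<Longrightarrow> p ! r \<notin> S"
      using adjacent_successors[OF sk'(1,3,2)] by metis
    \<comment> \<open>\<open>q\<close> takes the positions \<open>i + 1\<close> to \<open>j\<close>,
      so that the adjacent successors are \<open>hd q\<close> and \<open>hd bs\<close>, while
      \<open>x\<close> and \<open>last q\<close> are in \<open>N\<close>.\<close>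
    define as x q bs where "as = take i p" and "x = p ! i" and "q = take (j - i) (drop (Suc i) p)"
      and "bs = drop (Suc j) p"
    have "drop (Suc i) p = q @ drop (j - i) (drop (Suc i) p)"
      unfolding q_def by (rule append_take_drop_id[symmetric])
    also have "drop (j - i) (drop (Suc i) p) = bs"
      using ij(1) by (simp add: bs_def)
    finally have p: "p = as @ x # q @ bs"
      using ij(1,2) unfolding as_def x_def by (metis Cons_nth_drop_Suc Suc_lessD append_take_drop_id less_trans)
    have lq: "length q = j - i"
      using ij(1,2) by (simp add: q_def)
    have q: "q \<noteq> []" "hd q = p ! Suc i" "last q = p ! j" "bs \<noteq> []" "hd bs = p ! Suc j"
    proof -
      show "q \<noteq> []" using lq ij(1) by auto
      then show "hd q = p ! Suc i"
        using ij(1,2) lq by (simp add: hd_conv_nth) (simp add: q_def)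
      show "last q = p ! j"
        using \<open>q \<noteq> []\<close> ij(1,2) lq by (simp add: last_conv_nth) (simp add: q_def)
      show "bs \<noteq> []" "hd bs = p ! Suc j"
        using ij(2) by (simp_all add: bs_def hd_drop_conv_nth)
    qed
    have "set q \<inter> S = {}"
    proof -
      have "q ! l \<notin> S" if "l < j - i" for l
        using ij(6)[of "Suc i + l"] that ij(1,2) by (simp add: q_def)
      then show ?thesis
        using lq by (auto simp: in_set_conv_nth)
    qed
    obtain m where m: "m \<noteq> []" "distinct m" "set m \<subseteq> V - set p" "successively E m"
      "E (p ! i) (hd m)" "E (last m) (p ! j)"
      using connect[OF ij(3,4)] by blast
    have "skeleton S (as @ x # m @ rev q @ bs) \<and> successively E (as @ x # m @ rev q @ bs)"
    proof (rule skeleton_rotate)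
      show "skeleton S (as @ x # q @ bs)" "successively E (as @ x # q @ bs)"
        using sk path p by simp_all
      show "x \<notin> S" "hd bs \<notin> S"
        using ij(1,6) q by (simp_all add: x_def)
      show "set m \<subseteq> V - set (as @ x # q @ bs)"
        using m p by simp
    qed (use m q ij \<open>set q \<inter> S = {}\<close> in \<open>simp_all add: x_def\<close>)
    moreover have "hd (as @ x # m @ rev q @ bs) = hd p" "last (as @ x # m @ rev q @ bs) = last p"
      "length p < length (as @ x # m @ rev q @ bs)"
      unfolding p using q m by (cases as; simp)+
    ultimately show ?thesis
      by blast
  qed
qed

text \<open>Each enlargement keeps both ends and decreases \<open>card V - length p\<close>, so
  repetition ends with all vertices on the path.\<close>

lemma skeleton_hamiltonian:
  assumes "skeleton S p" "successively E p" "highly_connected c S" "(card S + 1) * k \<le> c"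
  shows "\<exists>h. distinct h \<and> h \<noteq> [] \<and> set h = V \<and> successively E h \<and> hd h = hd p \<and> last h = last p"
  using assms(1,2)
proof (induction "card V - length p" arbitrary: p rule: less_induct)
  case less
  show ?case
  proof (cases "set p = V")
    case True
    then show ?thesis
      using less.prems by (intro exI[of _ p]) (auto simp: skeleton_def)
  next
    case False
    then obtain v where "v \<in> V - set p"
      using less.prems by (auto simp: skeleton_def)
    then obtain p' where p': "skeleton S p'" "successively E p'" "hd p' = hd p" "last p' = last p"
      "length p < length p'"
      using skeleton_extend[OF less.prems assms(3,4)] by blast
    have "distinct p'" "set p' \<subseteq> V"
      using p' by (auto simp: skeleton_def)
    then have "length p' \<le> card V"
      using finite_V by (metis card_mono distinct_card)
    then show ?thesis
      using less.hyps[of p'] p' by auto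
  qed
qed

section \<open>Constructing a highly connected separator\<close>

text \<open>\<open>I\<close> has at most one vertex in each component of \<open>G - S\<close>. If
  the component of \<open>u\<close> has none, \<open>u\<close> is added and \<open>S\<close> stays.
  Otherwise deleting part of \<open>X\<close> separates \<open>u\<close> from \<open>w\<close>, and
  these two replace the representative \<open>i\<close>.\<close>

lemma reach_separated_step:
  assumes S: "S \<subseteq> V" "card S \<le> b" "I \<subseteq> V - S"
    and sep: "\<And>x y. \<lbrakk>x \<in> I; y \<in> I; reach S x y\<rbrakk> \<Longrightarrow> x = y"
    and bad: "\<not> highly_connected c S"
  obtains S' I' where "S' \<subseteq> V" "card S' \<le> b + c" "I' \<subseteq> V - S'" "card I' = Suc (card I)"
    "\<And>x y. \<lbrakk>x \<in> I'; y \<in> I'; reach S' x y\<rbrakk> \<Longrightarrow> x = y"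
proof -
  have "finite I"
    using S finite_V by (meson Diff_subset finite_subset)
  obtain X u w where X: "finite X" "card X \<le> c" "reach S u w" "u \<notin> X" "w \<notin> X" "\<not> reach (S \<union> X) u w"
    using bad unfolding highly_connected_def by blast
  have uw: "u \<in> V - S" "w \<in> V - S"
    using reach_mem X(3) by blast+
  show thesis
  proof (cases "\<exists>i\<in>I. reach S i u")
    case False
    then have nr: "\<not> reach S i u" "\<not> reach S u i" if "i \<in> I" for i
      using that reach_sym by blast+
    have "u \<notin> I"
      using nr reach_refl[OF uw(1)] by blast
    show thesis
    proof (rule that[of S "insert u I"])
      show "x = y" if "x \<in> insert u I" "y \<in> insert u I" "reach S x y" for x y
        using that nr sep by blast
    qed (use S uw \<open>u \<notin> I\<close> \<open>finite I\<close> in auto)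
  next
    case True
    then obtain i where i: "i \<in> I" "reach S i u" by blast
    \<comment> \<open>Only the vertices of \<open>X\<close> in the component of \<open>u\<close> are
      deleted, so the representatives of the other components survive.\<close>
    define S' where "S' = S \<union> {x \<in> X. reach S u x}"
    have SS: "S \<subseteq> S'"
      by (auto simp: S'_def)
    \<comment> \<open>A walk from \<open>u\<close> outside \<open>S'\<close> stays in the component
      of \<open>u\<close>, where \<open>S'\<close> contains all of \<open>X\<close>; hence it avoids
      \<open>X\<close> altogether.\<close>
    have nr: "\<not> reach S' u w"
    proof
      assume "reach S' u w"
      then have "w \<in> {x. reach (S \<union> X) u x}"
      proof (rule reach_induct)
        show "u \<in> {x. reach (S \<union> X) u x}"
          using uw X(4) reach_refl by blast
      next
        fix a b
        assume ab: "a \<in> {x. reach (S \<union> X) u x}" "b \<in> V - S'" "E a b"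
        then have "reach S u a"
          using reach_antimono by blast
        then have "reach S u b"
          using ab SS reach_step by blast
        then have "b \<notin> X"
          using ab by (auto simp: S'_def)
        then show "b \<in> {x. reach (S \<union> X) u x}"
          using ab SS reach_step by blast
      qed
      then show False using X(6) by blast
    qed
    have uw': "u \<in> V - S'" "w \<in> V - S'"
      using uw X by (auto simp: S'_def)
    have far: "\<not> reach S u y" if "y \<in> I - {i}" for y
    proof
      assume "reach S u y"
      then have "reach S i y"
        using i reach_trans by blast
      then show False
        using sep[OF i(1), of y] that by blast
    qed
    have farw: "\<not> reach S w y" if "y \<in> I - {i}" for y
      using far[OF that] X(3) reach_trans by blast
    have "u \<noteq> w"
      using nr reach_refl uw' by blast
    have notin: "u \<notin> I - {i}" "w \<notin> I - {i}"
      using far farw reach_refl uw by blast+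
    show thesis
    proof (rule that[of S' "insert u (insert w (I - {i}))"])
      show "S' \<subseteq> V"
        using S(1) reach_mem by (auto simp: S'_def)
      have "card S' \<le> card S + card {x \<in> X. reach S u x}"
        unfolding S'_def by (rule card_Un_le)
      also have "card {x \<in> X. reach S u x} \<le> card X"
        using X(1) by (intro card_mono) auto
      finally show "card S' \<le> b + c"
        using S(2) X(2) by simp
      show "insert u (insert w (I - {i})) \<subseteq> V - S'"
        using uw' S(3) far by (auto simp: S'_def)
      have "card (insert u (insert w (I - {i}))) = Suc (Suc (card (I - {i})))"
        using \<open>u \<noteq> w\<close> notin \<open>finite I\<close> by (subst card_insert_disjoint; simp)+
      also have "Suc (card (I - {i})) = card I"
        using i(1) \<open>finite I\<close> by (rule card_Suc_Diff1[rotated])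
      finally show "card (insert u (insert w (I - {i}))) = Suc (card I)" .
      show "x = y" if xy: "x \<in> insert u (insert w (I - {i}))" "y \<in> insert u (insert w (I - {i}))"
        "reach S' x y" for x y
      proof (rule ccontr)
        assume "x \<noteq> y"
        have r: "reach S x y" "reach S y x"
          using xy(3) SS reach_antimono reach_sym by blast+
        have "{x, y} = {u, w} \<or> (x \<in> {u, w} \<and> y \<in> I - {i}) \<or> (y \<in> {u, w} \<and> x \<in> I - {i}) \<or>
            (x \<in> I - {i} \<and> y \<in> I - {i})"
          using xy(1,2) \<open>x \<noteq> y\<close> by auto
        then consider "{x, y} = {u, w}" | "x \<in> {u, w}" "y \<in> I - {i}" | "y \<in> {u, w}" "x \<in> I - {i}" |
            "x \<in> I - {i}" "y \<in> I - {i}"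
          by blast
        then show False
        proof cases
          case 1
          then have "reach S' u w"
            using xy(3) reach_sym by (metis doubleton_eq_iff)
          then show False using nr by blast
        next
          case 2
          then show False using r far farw by blast
        next
          case 3
          then show False using r far farw by blast
        next
          case 4
          then show False using r sep \<open>x \<noteq> y\<close> by blast
        qed
      qed
    qed
  qed
qed

lemma ex_highly_connected:
  obtains S where "S \<subseteq> V" "card S \<le> separator_bound k k" "highly_connected ((3 * card S + 2) * (2 * k + 1)) S"
proof -
  define c where "c s = (3 * s + 2) * (2 * k + 1)" for s
  have c_mono: "c s \<le> c t" if "s \<le> t" for s t
    unfolding c_def using that by (intro mult_right_mono) auto
  \<comment> \<open>\<open>A j\<close> says that a suitable separator exists within the bound for
    \<open>j\<close> refinements, \<open>B j\<close> that some separator within this bound leaves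
    \<open>j\<close> vertices in different components. \<open>B k\<close> fails, since such vertices
    are independent.\<close>
  define A where "A j \<longleftrightarrow> (\<exists>S\<subseteq>V. card S \<le> separator_bound k j \<and> highly_connected (c (card S)) S)" for j
  define B where "B j \<longleftrightarrow> (\<exists>S\<subseteq>V. \<exists>I\<subseteq>V - S. card S \<le> separator_bound k j \<and> card I = j \<and>
      (\<forall>x\<in>I. \<forall>y\<in>I. reach S x y \<longrightarrow> x = y))" for j
  have "A j \<or> B j" for j
  proof (induction j)
    case 0
    have "B 0"
      unfolding B_def by (intro exI[of _ "{}"]) auto
    then show ?case ..
  next
    case (Suc j)
    then show ?case
    proof
      assume "A j"
      then have "A (Suc j)"
        unfolding A_def by (auto intro: order_trans)
      then show ?thesis ..
    next
      assume "B j"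
      then obtain S I where S: "S \<subseteq> V" "I \<subseteq> V - S" "card S \<le> separator_bound k j" "card I = j"
        "\<And>x y. \<lbrakk>x \<in> I; y \<in> I; reach S x y\<rbrakk> \<Longrightarrow> x = y"
        unfolding B_def by blast
      show ?thesis
      proof (cases "highly_connected (c (card S)) S")
        case True
        then have "A (Suc j)"
          unfolding A_def using S(1,3) by (intro exI[of _ S]) auto
        then show ?thesis ..
      next
        case False
        obtain S' I' where S': "S' \<subseteq> V" "card S' \<le> separator_bound k j + c (card S)" "I' \<subseteq> V - S'"
          "card I' = Suc (card I)" "\<And>x y. \<lbrakk>x \<in> I'; y \<in> I'; reach S' x y\<rbrakk> \<Longrightarrow> x = y"
          using reach_separated_step[OF S(1,3,2,5) False] by blast
        have "separator_bound k j + c (card S) \<le> separator_bound k (Suc j)"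
          using c_mono[OF S(3)] by (simp add: c_def)
        then have "B (Suc j)"
          unfolding B_def using S' S(4) by (intro exI[of _ S']) (auto intro!: exI[of _ I'])
        then show ?thesis ..
      qed
    qed
  qed
  moreover have "\<not> B k"
  proof
    assume "B k"
    then obtain S I where I: "I \<subseteq> V - S" "card I = k" "\<And>x y. \<lbrakk>x \<in> I; y \<in> I; reach S x y\<rbrakk> \<Longrightarrow> x = y"
      unfolding B_def by blast
    then obtain x y where xy: "x \<in> I" "y \<in> I" "E x y"
      using no_independent[of I] by blast
    then have "reach S x y"
      using I(1) reach_step[OF reach_refl] by blast
    then show False
      using I(3) xy irrefl by blast
  qed
  ultimately have "A k" by blast
  then show thesis
    unfolding A_def c_def using that by blast
qed

section \<open>Hamiltonian paths with given ends\<close>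

text \<open>From left to right the path has a short skeleton on every set; from right to left a
  single highly connected set is used. Sets are given by lists, ready for vertex quantifiers;
  repeated entries only weaken the length bound.\<close>

theorem hamiltonian_path_iff_skeletons:
  "(\<exists>p. distinct p \<and> p \<noteq> [] \<and> set p = V \<and> successively E p \<and> hd p = a \<and> last p = b) \<longleftrightarrow>
   (\<forall>xs. set xs \<subseteq> V \<and> length xs \<le> separator_bound k k \<longrightarrow>
      (\<exists>w. skeleton (set xs) w \<and> hd w = a \<and> last w = b \<and> length w \<le> 3 * length xs + 2))"
  (is "?L \<longleftrightarrow> ?R")
proof
  assume ?L
  then obtain p where p: "distinct p" "p \<noteq> []" "set p = V" "successively E p" "hd p = a" "last p = b"
    by blast
  show ?R
  proof (intro allI impI)
    fix xs
    assume "set xs \<subseteq> V \<and> length xs \<le> separator_bound k k"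
    then have "skeleton (set xs) p"
      using p by (intro hamiltonian_path_skeleton) auto
    then obtain w where "skeleton (set xs) w" "hd w = hd p" "last w = last p"
      "length w \<le> 3 * card (set xs) + 2"
      using skeleton_shorten by blast
    then show "\<exists>w. skeleton (set xs) w \<and> hd w = a \<and> last w = b \<and> length w \<le> 3 * length xs + 2"
      using p card_length[of xs] by (intro exI[of _ w]) auto
  qed
next
  assume R: ?R
  obtain S where S: "S \<subseteq> V" "card S \<le> separator_bound k k" "highly_connected ((3 * card S + 2) * (2 * k + 1)) S"
    by (rule ex_highly_connected)
  then obtain xs where xs: "set xs = S" "distinct xs"
    using finite_distinct_list finite_V finite_subset by metis
  then have "length xs = card S"
    using distinct_card by metis
  then obtain w where w: "skeleton S w" "hd w = a" "last w = b" "length w \<le> 3 * card S + 2"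
    using R S xs by metis
  then have "w \<noteq> []"
    by (simp add: skeleton_def)
  \<comment> \<open>Realization starts from the first vertex alone; its cost is at most
    \<open>length w * (2 * k + 1)\<close>, which the connectivity of \<open>S\<close>
    allows.\<close>
  then have ww: "[hd w] @ tl w = w"
    by simp
  have "length ([hd w] @ tl w) + 2 * k * length (tl w) \<le> length w + 2 * k * length w"
    unfolding ww by simp
  also have "\<dots> = length w * (2 * k + 1)"
    by (simp add: algebra_simps)
  also have "\<dots> \<le> (3 * card S + 2) * (2 * k + 1)"
    using w(4) by (intro mult_right_mono) auto
  finally obtain p where p: "skeleton S p" "successively E p" "hd p = hd w" "last p = last w"
    using skeleton_realize[of S "[hd w]" "tl w"] S(3) w(1) unfolding ww by auto
  \<comment> \<open>The same connectivity is large enough for enlarging the path.\<close>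
  have "(card S + 1) * k \<le> (3 * card S + 2) * (2 * k + 1)"
    by (intro mult_mono) auto
  then show ?L
    using skeleton_hamiltonian[OF p(1,2) S(3)] p w by metis
qed

end

section \<open>Skeletons in first-order logic\<close>

text \<open>
  Reachability needs only paths with fewer than \<open>2 * k\<close> vertices, so that every notion below is
  expressed with a number of vertex quantifiers that depends on \<open>k\<close> alone.
\<close>

definition short_reach where
  "short_reach k n E xs u v \<longleftrightarrow> (\<exists>l\<in>{1..<2 * k}. \<exists>q. length q = l \<and> set q \<subseteq> {..<n::nat} \<and>
     q ! 0 = u \<and> q ! (l - 1) = v \<and> (\<forall>i\<in>{..<l - 1}. E (q ! i) (q ! Suc i)) \<and>
     (\<forall>i\<in>{..<l}. q ! i \<notin> set xs))"

definition short_link where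
  "short_link k n E xs x y \<longleftrightarrow>
     (x \<in> set xs \<or> y \<in> set xs) \<and> E x y \<or>
     x \<notin> set xs \<and> y \<notin> set xs \<and> short_reach k n E xs x y"

text \<open>For \<open>v\<close> outside \<open>w\<close>, this is the negation of
  \<open>successively (misses (set xs) v) w\<close>, with \<open>short_reach\<close> in place of
  \<open>reach\<close>.\<close>

definition covered where
  "covered k n E xs w v \<longleftrightarrow> (\<exists>i\<in>{..<length w}. w ! i = v) \<or>
     (\<exists>i\<in>{..<length w - 1}. w ! i \<notin> set xs \<and> w ! Suc i \<notin> set xs \<and> short_reach k n E xs v (w ! i))"

definition short_skeleton where
  "short_skeleton k n E xs w a b \<longleftrightarrow>
     (\<forall>i\<in>{..<length w}. \<forall>j\<in>{..<length w}. i \<noteq> j \<longrightarrow> w ! i \<noteq> w ! j) \<and>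
     (\<forall>i\<in>{..<length xs}. \<exists>j\<in>{..<length w}. w ! j = xs ! i) \<and>
     w ! 0 = a \<and> w ! (length w - 1) = b \<and>
     (\<forall>i\<in>{..<length w - 1}. short_link k n E xs (w ! i) (w ! Suc i)) \<and>
     (\<forall>v<n. covered k n E xs w v)"

text \<open>The lengths \<open>m\<close> and \<open>l\<close> range over finite sets that depend on
  \<open>k\<close> alone, so they unfold to finite conjunctions and disjunctions; only the entries
  are quantified. A skeleton is nonempty, hence \<open>l\<close> starts at \<open>1\<close>.\<close>

definition all_skeletons where
  "all_skeletons k n E a b \<longleftrightarrow> (\<forall>m\<in>{..separator_bound k k}.
     \<forall>xs. length xs = m \<longrightarrow> set xs \<subseteq> {..<n} \<longrightarrow>
       (\<exists>l\<in>{1..3 * m + 2}. \<exists>w. length w = l \<and> set w \<subseteq> {..<n} \<and> short_skeleton k n E xs w a b))"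

section \<open>First-order decidability of the skeleton condition\<close>

lemma map_nth_append_left:
  "set ks \<subseteq> {..<length e} \<Longrightarrow> map ((!) (e @ ys)) ks = map ((!) e) ks"
  by (auto simp: nth_append)

lemma map_nth_append_right:
  "map ((!) (e @ ys)) [length e..<length e + length ys] = ys"
  by (rule nth_equalityI) auto

text \<open>Vertex lists enter formulas as lists \<open>ks\<close> of variable numbers, so that
  membership is a finite disjunction of equations.\<close>

lemma fo_decidable_mem:
  assumes "i < d" "set ks \<subseteq> {..<d}"
  shows "fo_decidable d (\<lambda>n E e. e ! i \<in> set (map ((!) e) ks))"
proof -
  have "fo_decidable d (\<lambda>n E e. \<exists>j\<in>set ks. e ! i = e ! j)"
    using assms by (intro fo_decidable_finite_ex fo_decidable_eq) auto
  then show ?thesis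
    by (rule fo_decidable_cong) auto
qed

lemma fo_decidable_short_reach:
  assumes "set ks \<subseteq> {..<d}" "i < d" "j < d"
  shows "fo_decidable d (\<lambda>n E e. short_reach k n E (map ((!) e) ks) (e ! i) (e ! j))"
  unfolding short_reach_def
proof (rule fo_decidable_finite_ex)
  fix l
  assume l: "l \<in> {1..<2 * k}"
  \<comment> \<open>The entries of \<open>q\<close> are the variables \<open>d\<close> to
    \<open>d + l - 1\<close>.\<close>
  let ?P = "\<lambda>n E e. e ! d = e ! i \<and> e ! (d + (l - 1)) = e ! j \<and>
     (\<forall>a\<in>{..<l - 1}. E (e ! (d + a)) (e ! (d + Suc a))) \<and>
     (\<forall>a\<in>{..<l}. e ! (d + a) \<notin> set (map ((!) e) ks))"
  have "fo_decidable (d + l) ?P"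
    using l assms by (intro fo_decidable_conj fo_decidable_eq fo_decidable_finite_all fo_decidable_edge fo_decidable_not fo_decidable_mem) auto
  from fo_decidable_ex_list[OF this]
  show "fo_decidable d (\<lambda>n E e. \<exists>q. length q = l \<and> set q \<subseteq> {..<n} \<and>
     q ! 0 = e ! i \<and> q ! (l - 1) = e ! j \<and> (\<forall>i\<in>{..<l - 1}. E (q ! i) (q ! Suc i)) \<and>
     (\<forall>i\<in>{..<l}. q ! i \<notin> set (map ((!) e) ks)))"
  proof (rule fo_decidable_cong, intro ex_cong1 conj_cong refl)
    fix n :: nat and E :: "nat \<Rightarrow> nat \<Rightarrow> bool" and e q :: "nat list"
    assume e: "length e = d" and q: "length q = l"
    have "(e @ q) ! (d + a) = q ! a" for a
      using e by (simp add: nth_append)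
    moreover have "(e @ q) ! a = e ! a" if "a < d" for a
      using e that by (simp add: nth_append)
    moreover have "map ((!) (e @ q)) ks = map ((!) e) ks"
      using assms e by (intro map_nth_append_left) auto
    moreover have "(e @ q) ! d = q ! 0"
      using e by (simp add: nth_append)
    ultimately show "((e @ q) ! d = (e @ q) ! i) = (q ! 0 = e ! i)"
      "((e @ q) ! (d + (l - 1)) = (e @ q) ! j) = (q ! (l - 1) = e ! j)"
      "(\<forall>a\<in>{..<l - 1}. E ((e @ q) ! (d + a)) ((e @ q) ! (d + Suc a))) =
       (\<forall>i\<in>{..<l - 1}. E (q ! i) (q ! Suc i))"
      "(\<forall>a\<in>{..<l}. (e @ q) ! (d + a) \<notin> set (map ((!) (e @ q)) ks)) =
       (\<forall>i\<in>{..<l}. q ! i \<notin> set (map ((!) e) ks))"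
      using assms by (simp_all only:)
  qed
qed simp

lemma fo_decidable_short_link:
  assumes "set ks \<subseteq> {..<d}" "i < d" "j < d"
  shows "fo_decidable d (\<lambda>n E e. short_link k n E (map ((!) e) ks) (e ! i) (e ! j))"
  unfolding short_link_def using assms
  by (intro fo_decidable_conj fo_decidable_disj fo_decidable_not fo_decidable_mem fo_decidable_edge fo_decidable_short_reach)

lemma fo_decidable_covered:
  assumes "set ks \<subseteq> {..<d}" "set js \<subseteq> {..<d}" "i < d"
  shows "fo_decidable d (\<lambda>n E e. covered k n E (map ((!) e) ks) (map ((!) e) js) (e ! i))"
proof -
  have js: "js ! a < d" if "a < length js" for a
    using assms that by (meson lessThan_iff nth_mem subsetD)
  have "fo_decidable d (\<lambda>n E e. (\<exists>a\<in>{..<length js}. e ! (js ! a) = e ! i) \<or>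
     (\<exists>a\<in>{..<length js - 1}. e ! (js ! a) \<notin> set (map ((!) e) ks) \<and> e ! (js ! Suc a) \<notin> set (map ((!) e) ks) \<and>
        short_reach k n E (map ((!) e) ks) (e ! i) (e ! (js ! a))))"
    using assms js by (intro fo_decidable_conj fo_decidable_disj fo_decidable_not fo_decidable_mem fo_decidable_eq fo_decidable_short_reach fo_decidable_finite_ex) auto
  then show ?thesis
    unfolding covered_def by (rule fo_decidable_cong) auto
qed

lemma fo_decidable_short_skeleton:
  assumes "set ks \<subseteq> {..<d}" "set js \<subseteq> {..<d}" "js \<noteq> []" "i < d" "j < d"
  shows "fo_decidable d (\<lambda>n E e. short_skeleton k n E (map ((!) e) ks) (map ((!) e) js) (e ! i) (e ! j))"
proof -
  have js: "js ! a < d" if "a < length js" for a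
    using assms that by (meson lessThan_iff nth_mem subsetD)
  have ks: "ks ! a < d" if "a < length ks" for a
    using assms that by (meson lessThan_iff nth_mem subsetD)
  \<comment> \<open>The vertex to be covered is the fresh variable \<open>d\<close>.\<close>
  have "fo_decidable (Suc d) (\<lambda>n E e. covered k n E (map ((!) e) ks) (map ((!) e) js) (e ! d))"
    using assms by (intro fo_decidable_covered) auto
  from fo_decidable_all[OF this]
  have "fo_decidable d (\<lambda>n E e. \<forall>v<n. covered k n E (map ((!) e) ks) (map ((!) e) js) v)"
  proof (rule fo_decidable_cong)
    fix n :: nat and E :: "nat \<Rightarrow> nat \<Rightarrow> bool" and e :: "nat list"
    assume e: "length e = d"
    have "map ((!) (e @ [x])) ks = map ((!) e) ks" "map ((!) (e @ [x])) js = map ((!) e) js"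
      "(e @ [x]) ! d = x" for x
      using assms e by (auto simp: nth_append)
    then show "(\<forall>x<n. covered k n E (map ((!) (e @ [x])) ks) (map ((!) (e @ [x])) js) ((e @ [x]) ! d)) =
       (\<forall>v<n. covered k n E (map ((!) e) ks) (map ((!) e) js) v)"
      by (simp only:)
  qed
  moreover have "fo_decidable d (\<lambda>n E e. \<forall>a\<in>{..<length js}. \<forall>b\<in>{..<length js}. a \<noteq> b \<longrightarrow> e ! (js ! a) \<noteq> e ! (js ! b))"
    using js by (intro fo_decidable_finite_all fo_decidable_imp fo_decidable_const fo_decidable_not fo_decidable_eq) auto
  moreover have "fo_decidable d (\<lambda>n E e. \<forall>a\<in>{..<length ks}. \<exists>b\<in>{..<length js}. e ! (js ! b) = e ! (ks ! a))"
    using js ks by (intro fo_decidable_finite_all fo_decidable_finite_ex fo_decidable_eq) auto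
  moreover have "fo_decidable d (\<lambda>n E e. e ! (js ! 0) = e ! i)" "fo_decidable d (\<lambda>n E e. e ! (js ! (length js - 1)) = e ! j)"
    using js assms by (auto intro!: fo_decidable_eq)
  moreover have "fo_decidable d (\<lambda>n E e. \<forall>a\<in>{..<length js - 1}. short_link k n E (map ((!) e) ks) (e ! (js ! a)) (e ! (js ! Suc a)))"
    using js assms by (intro fo_decidable_finite_all fo_decidable_short_link) auto
  ultimately have "fo_decidable d (\<lambda>n E e.
     (\<forall>a\<in>{..<length js}. \<forall>b\<in>{..<length js}. a \<noteq> b \<longrightarrow> e ! (js ! a) \<noteq> e ! (js ! b)) \<and>
     (\<forall>a\<in>{..<length ks}. \<exists>b\<in>{..<length js}. e ! (js ! b) = e ! (ks ! a)) \<and>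
     e ! (js ! 0) = e ! i \<and> e ! (js ! (length js - 1)) = e ! j \<and>
     (\<forall>a\<in>{..<length js - 1}. short_link k n E (map ((!) e) ks) (e ! (js ! a)) (e ! (js ! Suc a))) \<and>
     (\<forall>v<n. covered k n E (map ((!) e) ks) (map ((!) e) js) v))"
    by (intro fo_decidable_conj)
  then show ?thesis
    unfolding short_skeleton_def by (rule fo_decidable_cong) (use assms(3) in simp)
qed

lemma fo_decidable_all_skeletons:
  assumes "i < d" "j < d"
  shows "fo_decidable d (\<lambda>n E e. all_skeletons k n E (e ! i) (e ! j))"
  unfolding all_skeletons_def
proof (rule fo_decidable_finite_all)
  fix m
  \<comment> \<open>The entries of \<open>xs\<close> are the variables \<open>d\<close> to
    \<open>D - 1\<close>; those of \<open>w\<close> follow from \<open>D\<close> on.\<close>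
  have w: "fo_decidable D (\<lambda>n E e. \<exists>w. length w = l \<and> set w \<subseteq> {..<n} \<and>
      short_skeleton k n E (map ((!) e) [d..<D]) w (e ! i) (e ! j))" if D: "D = d + m" "1 \<le> l" for D l
  proof -
    have "fo_decidable (D + l) (\<lambda>n E e. short_skeleton k n E (map ((!) e) [d..<D]) (map ((!) e) [D..<D + l]) (e ! i) (e ! j))"
      using D assms by (intro fo_decidable_short_skeleton) auto
    from fo_decidable_ex_list[OF this] show ?thesis
    proof (rule fo_decidable_cong, intro ex_cong1 conj_cong refl)
      fix n :: nat and E :: "nat \<Rightarrow> nat \<Rightarrow> bool" and e w :: "nat list"
      assume e: "length e = D" and w: "length w = l"
      have "map ((!) (e @ w)) [d..<D] = map ((!) e) [d..<D]"
        using e by (intro map_nth_append_left) auto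
      moreover have "map ((!) (e @ w)) [D..<D + l] = w"
        using map_nth_append_right[of e w] e w by simp
      moreover have "(e @ w) ! i = e ! i" "(e @ w) ! j = e ! j"
        using e assms D by (simp_all add: nth_append)
      ultimately show "short_skeleton k n E (map ((!) (e @ w)) [d..<D]) (map ((!) (e @ w)) [D..<D + l]) ((e @ w) ! i) ((e @ w) ! j) =
        short_skeleton k n E (map ((!) e) [d..<D]) w (e ! i) (e ! j)"
        by (simp only:)
    qed
  qed
  have "fo_decidable (d + m) (\<lambda>n E e. \<exists>l\<in>{1..3 * m + 2}. \<exists>w. length w = l \<and> set w \<subseteq> {..<n} \<and>
      short_skeleton k n E (map ((!) e) [d..<d + m]) w (e ! i) (e ! j))"
    by (intro fo_decidable_finite_ex w) auto
  from fo_decidable_all_list[OF this]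
  show "fo_decidable d (\<lambda>n E e. \<forall>xs. length xs = m \<longrightarrow> set xs \<subseteq> {..<n} \<longrightarrow>
       (\<exists>l\<in>{1..3 * m + 2}. \<exists>w. length w = l \<and> set w \<subseteq> {..<n} \<and> short_skeleton k n E xs w (e ! i) (e ! j)))"
  proof (rule fo_decidable_cong, intro all_cong1 imp_cong refl)
    fix n :: nat and E :: "nat \<Rightarrow> nat \<Rightarrow> bool" and e xs :: "nat list"
    assume e: "length e = d" and xs: "length xs = m"
    have "map ((!) (e @ xs)) [d..<d + m] = xs"
      using map_nth_append_right[of e xs] e xs by simp
    moreover have "(e @ xs) ! i = e ! i" "(e @ xs) ! j = e ! j"
      using e assms by (simp_all add: nth_append)
    ultimately show "(\<exists>l\<in>{1..3 * m + 2}. \<exists>w. length w = l \<and> set w \<subseteq> {..<n} \<and>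
        short_skeleton k n E (map ((!) (e @ xs)) [d..<d + m]) w ((e @ xs) ! i) ((e @ xs) ! j)) =
      (\<exists>l\<in>{1..3 * m + 2}. \<exists>w. length w = l \<and> set w \<subseteq> {..<n} \<and> short_skeleton k n E xs w (e ! i) (e ! j))"
      by (simp only:)
  qed
qed simp

section \<open>Correctness of the first-order translation\<close>

locale bounded_independence_nat = bounded_independence "{..<n}" E k
  for n :: nat and E k

text \<open>The bound on independent sets enters in the direction from \<open>reach\<close> to
  \<open>short_reach\<close>: a shortest walk has fewer than \<open>2 * k\<close> vertices.\<close>

lemma (in bounded_independence_nat) short_reach_iff:
  shows "short_reach k n E xs u v \<longleftrightarrow> reach (set xs) u v"
proof
  assume "short_reach k n E xs u v"
  then obtain l q where q: "1 \<le> l" "length q = l" "set q \<subseteq> {..<n}" "q ! 0 = u" "q ! (l - 1) = v"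
    "\<forall>i<l - 1. E (q ! i) (q ! Suc i)" "\<forall>i<l. q ! i \<notin> set xs"
    unfolding short_reach_def by auto
  then have "q \<noteq> []" "successively E q" "set q \<subseteq> {..<n} - set xs"
    by (auto simp: successively_conv_nth in_set_conv_nth)
  then have "walk (set xs) u q v"
    using q by (auto simp: walk_def hd_conv_nth last_conv_nth)
  then show "reach (set xs) u v"
    by (auto simp: reach_def)
next
  assume "reach (set xs) u v"
  then obtain q where "walk (set xs) u q v" "length q < 2 * k"
    using reach_short by blast
  then have q: "q \<noteq> []" "hd q = u" "last q = v" "set q \<subseteq> {..<n} - set xs" "successively E q" "length q < 2 * k"
    by (auto simp: walk_def)
  moreover from q have "1 \<le> length q"
    by (simp add: Suc_le_eq)
  moreover have "q ! i \<notin> set xs" if "i < length q" for i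
    using q(4) that by (auto dest: nth_mem)
  ultimately show "short_reach k n E xs u v"
    unfolding short_reach_def
    by (intro bexI[of _ "length q"] exI[of _ q])
       (auto simp: hd_conv_nth last_conv_nth successively_conv_nth)
qed

lemma (in bounded_independence_nat) short_skeleton_iff:
  assumes "set w \<subseteq> {..<n}" "w \<noteq> []"
  shows "short_skeleton k n E xs w a b \<longleftrightarrow> skeleton (set xs) w \<and> hd w = a \<and> last w = b"
proof -
  have "short_link k n E xs x y \<longleftrightarrow> link (set xs) x y" for x y
    by (auto simp: short_link_def link_def short_reach_iff)
  then have 1: "(\<forall>i\<in>{..<length w - 1}. short_link k n E xs (w ! i) (w ! Suc i)) \<longleftrightarrow> successively (link (set xs)) w"
    by (auto simp: successively_conv_nth)
  have "covered k n E xs w v \<longleftrightarrow> v \<in> set w \<or> \<not> successively (misses (set xs) v) w" for v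
    unfolding covered_def short_reach_iff successively_conv_nth misses_def
    by (auto simp: in_set_conv_nth less_diff_conv)
  then have 2: "(\<forall>v<n. covered k n E xs w v) \<longleftrightarrow> (\<forall>v\<in>{..<n} - set w. \<not> successively (misses (set xs) v) w)"
    by auto
  have 3: "(\<forall>i\<in>{..<length xs}. \<exists>j\<in>{..<length w}. w ! j = xs ! i) \<longleftrightarrow> set xs \<subseteq> set w"
    by (auto simp: in_set_conv_nth subset_iff)
  have 4: "(\<forall>i\<in>{..<length w}. \<forall>j\<in>{..<length w}. i \<noteq> j \<longrightarrow> w ! i \<noteq> w ! j) \<longleftrightarrow> distinct w"
    by (auto simp: distinct_conv_nth)
  show ?thesis
    unfolding short_skeleton_def 1 2 3 4 skeleton_def using assms
    by (auto simp: hd_conv_nth last_conv_nth)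
qed

lemma (in bounded_independence_nat) all_skeletons_iff:
  shows "all_skeletons k n E a b \<longleftrightarrow>
    (\<exists>p. distinct p \<and> p \<noteq> [] \<and> set p = {..<n} \<and> successively E p \<and> hd p = a \<and> last p = b)"
proof -
  have "(\<exists>l\<in>{1..3 * length xs + 2}. \<exists>w. length w = l \<and> set w \<subseteq> {..<n} \<and> short_skeleton k n E xs w a b) \<longleftrightarrow>
      (\<exists>w. skeleton (set xs) w \<and> hd w = a \<and> last w = b \<and> length w \<le> 3 * length xs + 2)"
    (is "?L \<longleftrightarrow> ?R") for xs
  proof
    assume ?L
    then obtain w where w: "1 \<le> length w" "length w \<le> 3 * length xs + 2" "set w \<subseteq> {..<n}" "short_skeleton k n E xs w a b"
      by auto
    then have "w \<noteq> []" by auto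
    then show ?R
      using w short_skeleton_iff[of w xs a b] by auto
  next
    assume ?R
    then obtain w where w: "skeleton (set xs) w" "hd w = a" "last w = b" "length w \<le> 3 * length xs + 2"
      by blast
    then have "w \<noteq> []" "set w \<subseteq> {..<n}"
      by (auto simp: skeleton_def)
    then show ?L
      using w short_skeleton_iff[of w xs a b]
      by (intro bexI[of _ "length w"] exI[of _ w]) (auto simp: Suc_le_eq)
  qed
  note this[symmetric]
  moreover have "all_skeletons k n E a b \<longleftrightarrow> (\<forall>xs. set xs \<subseteq> {..<n} \<and> length xs \<le> separator_bound k k \<longrightarrow>
      (\<exists>l\<in>{1..3 * length xs + 2}. \<exists>w. length w = l \<and> set w \<subseteq> {..<n} \<and> short_skeleton k n E xs w a b))"
    unfolding all_skeletons_def by blast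
  ultimately show ?thesis
    unfolding hamiltonian_path_iff_skeletons by presburger
qed

section \<open>Transfer to graphs and the two decision problems\<close>

lemma bounded_independence_pair_graph:
  assumes "pair_graph G" "kK1_free k G"
  shows "bounded_independence (pverts G) (\<lambda>u v. (u, v) \<in> parcs G) k"
proof -
  interpret pair_graph G by fact
  show ?thesis
  proof
    show "finite (pverts G)" by (rule pair_finite_verts)
    show "(y, x) \<in> parcs G" if "(x, y) \<in> parcs G" for x y
      using that arcs_symmetric by simp
    show "(x, x) \<notin> parcs G" for x
      using pair_no_loops[of "(x, x)"] by auto
    show "\<exists>x\<in>I. \<exists>y\<in>I. (x, y) \<in> parcs G" if "I \<subseteq> pverts G" "card I = k" for I
      using that assms kK1_free_iff_no_independent_set[OF assms(1)]
      by (auto simp: independent_set_def)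
  qed
qed

lemma vwalk_arcs_subset_iff:
  "set (vwalk_arcs p) \<subseteq> A \<longleftrightarrow> successively (\<lambda>u v. (u, v) \<in> A) p"
  by (induction p rule: vwalk_arcs.induct) auto

lemma vpath_with_proj_iff:
  "vpath p (with_proj G) \<longleftrightarrow> p \<noteq> [] \<and> distinct p \<and> set p \<subseteq> pverts G \<and>
     successively (\<lambda>u v. (u, v) \<in> parcs G) p"
  by (auto simp: vpath_def vwalk_def vwalk_arcs_subset_iff)

theorem theorem1:
  fixes k :: nat
  shows "(\<exists>c. decides_in_poly_time c (kK1_free k) has_hamiltonian_path) \<and>
         (\<exists>c. decides_in_poly_time c (kK1_free k) has_hamiltonian_cycle)"
proof
  have "fo_decidable (Suc (Suc 0)) (\<lambda>n E e. all_skeletons k n E (e ! 0) (e ! 1))"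
    by (rule fo_decidable_all_skeletons) auto
  from fo_decidable_ex[OF fo_decidable_ex[OF this]]
  have fo_decidable: "fo_decidable 0 (\<lambda>n E e. \<exists>a<n. \<exists>b<n. all_skeletons k n E a b)"
    by (rule fo_decidable_cong) (simp add: nth_append)
  show "\<exists>c. decides_in_poly_time c (kK1_free k) has_hamiltonian_path"
  proof (rule decides_in_poly_timeI[OF fo_decidable])
    fix n and G :: "nat pair_pre_digraph"
    assume G: "pair_graph G" "pverts G = {..<n}" "kK1_free k G"
    interpret bounded_independence_nat n "\<lambda>u v. (u, v) \<in> parcs G" k
      using bounded_independence_pair_graph[OF G(1,3)] G(2) by (simp add: bounded_independence_nat_def)
    show "has_hamiltonian_path G \<longleftrightarrow> (\<exists>a<n. \<exists>b<n. all_skeletons k n (\<lambda>u v. (u, v) \<in> parcs G) a b)"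
      (is "_ \<longleftrightarrow> ?R")
    proof
      assume "has_hamiltonian_path G"
      then obtain p where p: "p \<noteq> []" "distinct p" "set p = pverts G" "successively (\<lambda>u v. (u, v) \<in> parcs G) p"
        by (auto simp: has_hamiltonian_path_def vpath_with_proj_iff)
      then have "hd p < n" "last p < n"
        using G(2) hd_in_set[of p] last_in_set[of p] by auto
      then show ?R
        unfolding all_skeletons_iff using p G(2) by blast
    next
      assume ?R
      then show "has_hamiltonian_path G"
        unfolding all_skeletons_iff has_hamiltonian_path_def vpath_with_proj_iff G(2) by blast
    qed
  qed
next
  \<comment> \<open>A Hamiltonian cycle is a Hamiltonian path from \<open>a\<close> to
    \<open>b\<close> closed by an edge from \<open>b\<close> to \<open>a\<close>. The third vertex
    \<open>c\<close> expresses that the cycle has at least three vertices.\<close>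
  have "fo_decidable (Suc (Suc (Suc 0))) (\<lambda>n E e. e ! 2 \<noteq> e ! 0 \<and> e ! 2 \<noteq> e ! 1 \<and> E (e ! 1) (e ! 0) \<and>
      all_skeletons k n E (e ! 0) (e ! 1))"
    by (intro fo_decidable_conj fo_decidable_not fo_decidable_eq fo_decidable_edge fo_decidable_all_skeletons) auto
  from fo_decidable_ex[OF fo_decidable_ex[OF fo_decidable_ex[OF this]]]
  have fo_decidable: "fo_decidable 0 (\<lambda>n E e. \<exists>a<n. \<exists>b<n. \<exists>c<n. c \<noteq> a \<and> c \<noteq> b \<and> E b a \<and> all_skeletons k n E a b)"
    by (rule fo_decidable_cong) (simp add: nth_append numeral_2_eq_2)
  show "\<exists>c. decides_in_poly_time c (kK1_free k) has_hamiltonian_cycle"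
  proof (rule decides_in_poly_timeI[OF fo_decidable])
    fix n and G :: "nat pair_pre_digraph"
    assume G: "pair_graph G" "pverts G = {..<n}" "kK1_free k G"
    interpret bounded_independence_nat n "\<lambda>u v. (u, v) \<in> parcs G" k
      using bounded_independence_pair_graph[OF G(1,3)] G(2) by (simp add: bounded_independence_nat_def)
    show "has_hamiltonian_cycle G \<longleftrightarrow> (\<exists>a<n. \<exists>b<n. \<exists>c<n. c \<noteq> a \<and> c \<noteq> b \<and> (b, a) \<in> parcs G \<and>
        all_skeletons k n (\<lambda>u v. (u, v) \<in> parcs G) a b)"
      (is "_ \<longleftrightarrow> ?R")
    proof
      assume "has_hamiltonian_cycle G"
      then obtain p where p: "p \<noteq> []" "distinct p" "set p = pverts G" "successively (\<lambda>u v. (u, v) \<in> parcs G) p"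
        "3 \<le> length p" "(last p, hd p) \<in> parcs G"
        by (auto simp: has_hamiltonian_cycle_def vpath_with_proj_iff)
      \<comment> \<open>As the length is at least \<open>3\<close>, position \<open>1\<close> is
        neither end, so \<open>p ! 1\<close> serves as the third vertex.\<close>
      then have "p ! 1 \<noteq> hd p" "p ! 1 \<noteq> last p"
        by (auto simp: hd_conv_nth last_conv_nth nth_eq_iff_index_eq)
      moreover have "hd p < n" "last p < n" "p ! 1 < n"
        using p G(2) hd_in_set[of p] last_in_set[of p] nth_mem[of 1 p] by auto
      ultimately show ?R
        unfolding all_skeletons_iff using p G(2) by blast
    next
      assume ?R
      then obtain p c where p: "p \<noteq> []" "distinct p" "set p = pverts G"
        "successively (\<lambda>u v. (u, v) \<in> parcs G) p" "(last p, hd p) \<in> parcs G"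
        "c < n" "c \<noteq> hd p" "c \<noteq> last p"
        unfolding all_skeletons_iff G(2) by blast
      \<comment> \<open>The ends differ because the closing edge is not a loop; together with
        \<open>c\<close> they are three vertices.\<close>
      have "hd p \<noteq> last p"
        using p(5) irrefl by metis
      then have "card {c, hd p, last p} = 3"
        using p by simp
      moreover have "card {c, hd p, last p} \<le> card (set p)"
        using hd_in_set[OF p(1)] last_in_set[OF p(1)] p(3,6) G(2) by (intro card_mono) simp_all
      ultimately have "3 \<le> length p"
        using distinct_card[OF p(2)] by linarith
      with p show "has_hamiltonian_cycle G"
        unfolding has_hamiltonian_cycle_def vpath_with_proj_iff by blast
    qed
  qed
qed

end
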